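(* Consider the power network model written as the singular perturbation problem with state $(\delta,\dot\theta)\in\mathbb R^{n-1}\times\mathbb R^n$ $$\frac{d}{dt}\delta_i=\dot\theta_i-\dot\theta_n,\quad i\in\{1,\dots,n-1\},$$ $$\epsilon\frac{d}{dt}\dot\theta_i=-F_i\dot\theta_i+\frac{F_i}{D_i}\Big(\omega_i-\sum_{j=1}^nP_{ij}\sin(\delta_i-\delta_j+\varphi_{ij})\Big),\quad i\in\{1,\dots,n\},\qquad(\mathrm{SP})$$ where $\delta_n:=0$, with bounded initial conditions $(\delta(0),\dot\theta(0))$, and the grounded Kuramoto model with state in $\mathbb R^{n-1}$ $$\dot\delta_i=\frac{\omega_i}{D_i}-\frac{\omega_n}{D_n}-\sum_{j=1,j\ne i}^{n-1}\Big(\frac{P_{ij}}{D_i}\sin(\delta_i-\delta_j+\varphi_{ij})+\frac{P_{nj}}{D_n}\sin(\delta_j-\varphi_{jn})\Big)-\Big(\frac{P_{in}}{D_i}\sin(\delta_i+\varphi_{in})+\frac{P_{in}}{D_n}\sin(\delta_i-\varphi_{in})\Big),\qquad(\mathrm{GK})$$ $i\in\{1,\dots,n-1\}$, with initial condition $\delta(0)$ and solution $\bar\delta(t)$. Assume that there exists an exponentially stable fixed point $\delta_\infty$ of (GK) and that $\delta(0)$ is in a compact subset $\Omega_\delta$ of its region of attraction. Then, for each $\Omega_\delta$: 1) there exists $\epsilon_*>0$ such that for all $\epsilon<\epsilon_*$, the singular perturbation problem (SP) has a unique solution $(\delta(t,\epsilon),\dot\theta(t,\epsilon))$ for $t\ge0$,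 and for all $t\ge0$ it holds uniformly in $t$ that $$\delta(t,\epsilon)-\bar\delta(t)=\mathcal O(\epsilon)\quad\text{and}\quad\dot\theta(t,\epsilon)-h(\bar\delta(t))-y(t/\epsilon)=\mathcal O(\epsilon),$$ where $y_i(t/\epsilon):=(\dot\theta_i(0)-h_i(\delta(0)))\,e^{-F_it/\epsilon}$ and $h_i(\delta):=Q_i(\delta)/D_i$ for $i\in\{1,\dots,n\}$; 2) for any $t_b>0$, there exists $\epsilon^*\le\epsilon_*$ such that for all $t\ge t_b$ and whenever $\epsilon<\epsilon^*$ it holds uniformly that $$\dot\theta(t,\epsilon)-h(\bar\delta(t))=\mathcal O(\epsilon);$$ 3) additionally, there exist $\epsilon$ and $\varphi_{\max}$ sufficiently small such that the approximation errors in 1) and 2) converge exponentially to zero as $t\to\infty$.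
   Context: Parameters: $n\ge2$; $M_i>0$, $D_i>0$, $\omega_i\in\mathbb R$; $P_{ij}=P_{ji}>0$ and $\varphi_{ij}=\varphi_{ji}\in[0,\pi/2[$ for $i\ne j$; $P_{ii}=0$, $\varphi_{ii}=0$; $\varphi_{\max}=\max_{i,j}\varphi_{ij}$. The underlying power network model is $M_i\ddot\theta_i=-D_i\dot\theta_i+\omega_i-\sum_{j=1}^nP_{ij}\sin(\theta_i-\theta_j+\varphi_{ij})$, $\delta_i=\theta_i-\theta_n$, and the singular perturbation parameter is $\epsilon:=M_{\max}/D_{\min}>0$ with $M_{\max}=\max_iM_i$, $D_{\min}=\min_iD_i$, and $F_i:=(D_i/D_{\min})/(M_i/M_{\max})$. As usual in singular perturbation theory, (SP) is regarded as a family of systems in the parameter $\epsilon>0$ with the other coefficients ($F_i$, $D_i$, $\omega_i$, $P_{ij}$, $\varphi_{ij}$) fixed. With $\delta_n:=0$, $Q_i(\delta):=\omega_i-\sum_{j=1}^nP_{ij}\sin(\delta_i-\delta_j+\varphi_{ij})$ for $i\in\{1,\dots,n\}$. *)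

theory Defs
  imports "HOL-Analysis.Analysis"
begin

text \<open>
  The nodes 1, ..., n (n at least 2) are the elements of \<open>'m option\<close>, where the finite type
  \<open>'m\<close> has n - 1 elements: \<open>None\<close> is the grounded node n, and \<open>Some k\<close> are the nodes
  1, ..., n - 1. Hence \<open>\<delta>\<close> lives in \<open>real ^ 'm\<close> and the frequencies in \<open>real ^ 'm option\<close>.
\<close>

definition grounded :: "real ^ 'm::finite \<Rightarrow> 'm option \<Rightarrow> real" where
  "grounded \<delta> i = (case i of None \<Rightarrow> 0 | Some k \<Rightarrow> \<delta> $ k)"

definition F_coeff :: "('m::finite option \<Rightarrow> real) \<Rightarrow> ('m option \<Rightarrow> real) \<Rightarrow> 'm option \<Rightarrow> real" where
  "F_coeff M D i = (D i / Min (range D)) / (M i / Max (range M))"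

definition coupling_weights :: "('a \<Rightarrow> 'a \<Rightarrow> real) \<Rightarrow> bool" where
  "coupling_weights P \<longleftrightarrow>
     (\<forall>i j. P i j = P j i) \<and> (\<forall>i j. i \<noteq> j \<longrightarrow> P i j > 0) \<and> (\<forall>i. P i i = 0)"

definition phase_shifts :: "('a \<Rightarrow> 'a \<Rightarrow> real) \<Rightarrow> bool" where
  "phase_shifts \<phi> \<longleftrightarrow>
     (\<forall>i j. \<phi> i j = \<phi> j i) \<and> (\<forall>i j. i \<noteq> j \<longrightarrow> 0 \<le> \<phi> i j \<and> \<phi> i j < pi / 2) \<and> (\<forall>i. \<phi> i i = 0)"

definition phi_max :: "('a::finite \<Rightarrow> 'a \<Rightarrow> real) \<Rightarrow> real" where
  "phi_max \<phi> = Max {\<phi> i j | i j. True}"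

definition Q :: "('m::finite option \<Rightarrow> real) \<Rightarrow> ('m option \<Rightarrow> 'm option \<Rightarrow> real) \<Rightarrow>
    ('m option \<Rightarrow> 'm option \<Rightarrow> real) \<Rightarrow> real ^ 'm \<Rightarrow> 'm option \<Rightarrow> real" where
  "Q \<omega> P \<phi> \<delta> i = \<omega> i - (\<Sum>j\<in>UNIV. P i j * sin (grounded \<delta> i - grounded \<delta> j + \<phi> i j))"

definition h :: "('m::finite option \<Rightarrow> real) \<Rightarrow> ('m option \<Rightarrow> real) \<Rightarrow>
    ('m option \<Rightarrow> 'm option \<Rightarrow> real) \<Rightarrow> ('m option \<Rightarrow> 'm option \<Rightarrow> real) \<Rightarrow>
    real ^ 'm \<Rightarrow> real ^ 'm option" where
  "h D \<omega> P \<phi> \<delta> = (\<chi> i. Q \<omega> P \<phi> \<delta> i / D i)"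

definition grounded_kuramoto :: "('m::finite option \<Rightarrow> real) \<Rightarrow> ('m option \<Rightarrow> real) \<Rightarrow>
    ('m option \<Rightarrow> 'm option \<Rightarrow> real) \<Rightarrow> ('m option \<Rightarrow> 'm option \<Rightarrow> real) \<Rightarrow>
    real ^ 'm \<Rightarrow> real ^ 'm" where
  "grounded_kuramoto D \<omega> P \<phi> \<delta> = (\<chi> i.
     \<omega> (Some i) / D (Some i) - \<omega> None / D None
     - (\<Sum>j\<in>UNIV - {i}.
          P (Some i) (Some j) / D (Some i) * sin (\<delta> $ i - \<delta> $ j + \<phi> (Some i) (Some j))
          + P None (Some j) / D None * sin (\<delta> $ j - \<phi> (Some j) None))
     - (P (Some i) None / D (Some i) * sin (\<delta> $ i + \<phi> (Some i) None)
        + P (Some i) None / D None * sin (\<delta> $ i - \<phi> (Some i) None)))"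

text \<open>Solutions on the time interval from 0 to infinity; values at negative times are irrelevant.\<close>

definition ivp_solution :: "('a::real_normed_vector \<Rightarrow> 'a) \<Rightarrow> 'a \<Rightarrow> (real \<Rightarrow> 'a) \<Rightarrow> bool" where
  "ivp_solution f x0 x \<longleftrightarrow>
     x 0 = x0 \<and> (\<forall>t\<ge>0. (x has_vector_derivative f (x t)) (at t within {0..}))"

definition SP_solution :: "('m::finite option \<Rightarrow> real) \<Rightarrow> ('m option \<Rightarrow> real) \<Rightarrow>
    ('m option \<Rightarrow> real) \<Rightarrow> ('m option \<Rightarrow> 'm option \<Rightarrow> real) \<Rightarrow>
    ('m option \<Rightarrow> 'm option \<Rightarrow> real) \<Rightarrow> real \<Rightarrow> real ^ 'm \<Rightarrow> real ^ 'm option \<Rightarrow>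
    (real \<Rightarrow> real ^ 'm) \<Rightarrow> (real \<Rightarrow> real ^ 'm option) \<Rightarrow> bool" where
  "SP_solution F D \<omega> P \<phi> \<epsilon> \<delta>0 v0 \<delta> v \<longleftrightarrow>
     \<delta> 0 = \<delta>0 \<and> v 0 = v0 \<and>
     (\<forall>t\<ge>0.
        (\<forall>i. ((\<lambda>s. \<delta> s $ i) has_real_derivative v t $ Some i - v t $ None) (at t within {0..})) \<and>
        (\<forall>i. ((\<lambda>s. v s $ i) has_real_derivative
                (- F i * v t $ i + F i / D i * Q \<omega> P \<phi> (\<delta> t) i) / \<epsilon>) (at t within {0..})))"

definition SP_has_unique_solution :: "('m::finite option \<Rightarrow> real) \<Rightarrow> ('m option \<Rightarrow> real) \<Rightarrow>
    ('m option \<Rightarrow> real) \<Rightarrow> ('m option \<Rightarrow> 'm option \<Rightarrow> real) \<Rightarrow>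
    ('m option \<Rightarrow> 'm option \<Rightarrow> real) \<Rightarrow> real \<Rightarrow> real ^ 'm \<Rightarrow> real ^ 'm option \<Rightarrow> bool" where
  "SP_has_unique_solution F D \<omega> P \<phi> \<epsilon> \<delta>0 v0 \<longleftrightarrow>
     (\<exists>\<delta> v. SP_solution F D \<omega> P \<phi> \<epsilon> \<delta>0 v0 \<delta> v \<and>
        (\<forall>\<delta>' v'. SP_solution F D \<omega> P \<phi> \<epsilon> \<delta>0 v0 \<delta>' v' \<longrightarrow>
           (\<forall>t\<ge>0. \<delta>' t = \<delta> t \<and> v' t = v t)))"

definition boundary_layer :: "('m::finite option \<Rightarrow> real) \<Rightarrow> ('m option \<Rightarrow> real) \<Rightarrow>
    ('m option \<Rightarrow> real) \<Rightarrow> ('m option \<Rightarrow> 'm option \<Rightarrow> real) \<Rightarrow>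
    ('m option \<Rightarrow> 'm option \<Rightarrow> real) \<Rightarrow> real ^ 'm \<Rightarrow> real ^ 'm option \<Rightarrow>
    real \<Rightarrow> real ^ 'm option" where
  "boundary_layer F D \<omega> P \<phi> \<delta>0 v0 \<tau> =
     (\<chi> i. (v0 $ i - h D \<omega> P \<phi> \<delta>0 $ i) * exp (- F i * \<tau>))"

definition exponentially_stable_fixed_point ::
    "('a::real_normed_vector \<Rightarrow> 'a) \<Rightarrow> 'a \<Rightarrow> bool" where
  "exponentially_stable_fixed_point f xs \<longleftrightarrow> f xs = 0 \<and>
     (\<exists>r k c. r > 0 \<and> k > 0 \<and> c > 0 \<and> (\<forall>x0. norm (x0 - xs) < r \<longrightarrow>
        (\<exists>x. ivp_solution f x0 x) \<and>
        (\<forall>x. ivp_solution f x0 x \<longrightarrow>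
           (\<forall>t\<ge>0. norm (x t - xs) \<le> k * norm (x0 - xs) * exp (- c * t)))))"

definition region_of_attraction :: "('a::real_normed_vector \<Rightarrow> 'a) \<Rightarrow> 'a \<Rightarrow> 'a set" where
  "region_of_attraction f xs =
     {x0. (\<exists>x. ivp_solution f x0 x) \<and> (\<forall>x. ivp_solution f x0 x \<longrightarrow> (x \<longlongrightarrow> xs) at_top)}"

definition converges_exponentially_to_zero :: "(real \<Rightarrow> 'a::real_normed_vector) \<Rightarrow> bool" where
  "converges_exponentially_to_zero e \<longleftrightarrow>
     (\<exists>C c. c > 0 \<and> (\<forall>t\<ge>0. norm (e t) \<le> C * exp (- c * t)))"

end

theory Submission
  imports Defs
begin

text \<open>
  In the vector form \<open>x' = B v\<close>, \<open>\<epsilon> v\<^sub>i' = F\<^sub>i (h\<^sub>i(x) - v\<^sub>i)\<close> of the network model, the fast variable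
  relaxes linearly towards \<open>h(x)\<close>, and the grounded Kuramoto field is \<open>g = B \<circ> h\<close>. The
  linearity of the relaxation makes a change of variables available that removes the boundary
  layer from the slow equation: with \<open>F\<close> read as a diagonal matrix, \<open>w = x + \<epsilon> B F\<^sup>-\<^sup>1 v\<close> satisfies
  \<open>w' = g(x)\<close> exactly (\<open>corrected_derivative\<close>). Since \<open>h\<close> is bounded, \<open>v\<close> is bounded uniformly in
  time and in \<open>\<epsilon>\<close>, so \<open>w - x = O(\<epsilon>)\<close>, and \<open>w\<close> solves the reduced equation \<open>w' = g(w)\<close> up to an
  error \<open>O(\<epsilon>)\<close> that is uniform on the whole half-line.

  It remains to see that an exponentially stable equation tolerates such errors for all times
  (\<open>uniform_tracking\<close>). Near the fixed point, the flow over a suitable time \<open>T\<close> halves the distance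
  of any two nearby solutions (\<open>local_contraction\<close>), so errors made in the successive time windows
  form a geometric series; a compact set of initial values enters that neighbourhood within a
  common finite time (\<open>uniform_entry_time\<close>), during which Gronwall's inequality suffices. This gives
  \<open>x - xbar = O(\<epsilon>)\<close>. The error of the fast variable, with the layer term subtracted, vanishes
  initially and obeys a linear relaxation equation with an inhomogeneity of size \<open>O(\<epsilon>)\<close>, relative
  to its rate; hence it is \<open>O(\<epsilon>)\<close> as well (\<open>fast_approximation\<close>). After a positive time the layer
  is itself \<open>O(\<epsilon>)\<close>.

  For the exponential convergence, the point \<open>(x\<^sub>*, h(x\<^sub>*))\<close> is an equilibrium of the full system
  for every \<open>\<epsilon>\<close>. Close to it, \<open>|w - x\<^sub>*|\<close> is contracted over a window of length \<open>T\<close> up to a term of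
  order \<open>\<epsilon>\<close>, while \<open>|v - h(x\<^sub>*)|\<close> at the end of the window is controlled by \<open>|w - x\<^sub>*|\<close> up to a
  term of order \<open>\<epsilon>\<close>. For small \<open>\<epsilon>\<close> a weighted sum of both decreases geometrically
  (\<open>local_exponential_decay\<close>), and the uniform estimate guarantees that every trajectory under
  consideration eventually comes close enough.
\<close>

section \<open>Comparison estimates for differential inequalities\<close>

lemma nonincreasing_within:
  fixes f :: "real \<Rightarrow> real"
  assumes "a \<le> b"
    and der: "\<And>t. t \<in> {a..b} \<Longrightarrow> (f has_real_derivative f' t) (at t within {a..b})"
    and nonpos: "\<And>t. t \<in> {a..b} \<Longrightarrow> f' t \<le> 0"
  shows "f b \<le> f a"
proof (rule DERIV_nonpos_imp_decreasing_open [OF \<open>a \<le> b\<close>])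
  show "continuous_on {a..b} f"
    by (rule DERIV_continuous_on) (rule der)
  fix t assume t: "a < t" "t < b"
  then have "(f has_real_derivative f' t) (at t)"
    using der[of t] at_within_Icc_at[of a t b] by auto
  then show "\<exists>y. DERIV f t :> y \<and> y \<le> 0"
    using nonpos[of t] t by auto
qed

text \<open>
  The energy \<open>|d|\<^sup>2 + \<eta>\<^sup>2\<close> grows at most at the rate \<open>2 L + 1\<close>, because \<open>2 |d| \<eta> \<le> |d|\<^sup>2 + \<eta>\<^sup>2\<close>. Working
  with the squared norm avoids differentiating the norm at \<open>0\<close>, at the price of \<open>L + 1\<close> instead of
  \<open>L\<close> in the exponent.
\<close>

lemma gronwall_norm:
  fixes d :: "real \<Rightarrow> 'a::real_inner"
  assumes der: "\<And>t. t \<in> {a..b} \<Longrightarrow> (d has_vector_derivative d' t) (at t within {a..b})"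
    and bound: "\<And>t. t \<in> {a..b} \<Longrightarrow> norm (d' t) \<le> L * norm (d t) + \<eta>"
    and "0 \<le> L" "0 \<le> \<eta>" "a \<le> b"
  shows "norm (d b) \<le> exp ((L + 1) * (b - a)) * (norm (d a) + \<eta>)"
proof -
  define m where "m = 2 * L + 1"
  define E where "E = (\<lambda>s. (d s \<bullet> d s + \<eta>\<^sup>2) * exp (- m * (s - a)))"
  have "E b \<le> E a"
  proof (rule nonincreasing_within[OF \<open>a \<le> b\<close>])
    fix t assume t: "t \<in> {a..b}"
    have dd: "((\<lambda>s. d s \<bullet> d s) has_real_derivative 2 * (d t \<bullet> d' t)) (at t within {a..b})"
    proof -
      have "((\<lambda>s. d s \<bullet> d s) has_derivative (\<lambda>k. d t \<bullet> (k *\<^sub>R d' t) + (k *\<^sub>R d' t) \<bullet> d t)) (at t within {a..b})"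
        by (rule has_derivative_inner) (use der[OF t] in \<open>simp_all add: has_vector_derivative_def\<close>)
      then show ?thesis
        unfolding has_field_derivative_def
        by (rule has_derivative_eq_rhs) (auto simp: inner_commute algebra_simps)
    qed
    show "(E has_real_derivative (2 * (d t \<bullet> d' t) - m * (d t \<bullet> d t + \<eta>\<^sup>2)) * exp (- m * (t - a))) (at t within {a..b})"
      unfolding E_def by (rule derivative_eq_intros dd refl | simp add: algebra_simps)+
    have "2 * (d t \<bullet> d' t) \<le> 2 * (norm (d t) * norm (d' t))"
      using norm_cauchy_schwarz[of "d t" "d' t"] by simp
    also have "\<dots> \<le> 2 * (norm (d t) * (L * norm (d t) + \<eta>))"
      by (intro mult_left_mono bound[OF t]) auto
    also have "\<dots> = 2 * L * (norm (d t))\<^sup>2 + 2 * norm (d t) * \<eta>"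
      by (simp add: algebra_simps power2_eq_square)
    also have "\<dots> \<le> 2 * L * (norm (d t))\<^sup>2 + ((norm (d t))\<^sup>2 + \<eta>\<^sup>2)"
      using sum_squares_bound[of "norm (d t)" \<eta>] by simp
    also have "\<dots> \<le> m * (d t \<bullet> d t + \<eta>\<^sup>2)"
      using \<open>0 \<le> L\<close> by (simp add: m_def algebra_simps dot_square_norm)
    finally show "(2 * (d t \<bullet> d' t) - m * (d t \<bullet> d t + \<eta>\<^sup>2)) * exp (- m * (t - a)) \<le> 0"
      by (simp add: mult_nonpos_nonneg)
  qed
  then have "((norm (d b))\<^sup>2 + \<eta>\<^sup>2) * exp (- m * (b - a)) * exp (m * (b - a))
      \<le> ((norm (d a))\<^sup>2 + \<eta>\<^sup>2) * exp (m * (b - a))"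
    by (intro mult_right_mono) (auto simp: E_def dot_square_norm)
  then have "(norm (d b))\<^sup>2 + \<eta>\<^sup>2 \<le> ((norm (d a))\<^sup>2 + \<eta>\<^sup>2) * exp (m * (b - a))"
    by (simp add: mult.assoc flip: exp_add)
  then have "(norm (d b))\<^sup>2 \<le> ((norm (d a))\<^sup>2 + \<eta>\<^sup>2) * exp (m * (b - a))"
    using zero_le_power2[of \<eta>] by linarith
  also have "\<dots> \<le> (norm (d a) + \<eta>)\<^sup>2 * (exp ((L + 1) * (b - a)))\<^sup>2"
  proof (rule mult_mono)
    show "(norm (d a))\<^sup>2 + \<eta>\<^sup>2 \<le> (norm (d a) + \<eta>)\<^sup>2"
      using \<open>0 \<le> \<eta>\<close> by (simp add: power2_sum)
    have "m * (b - a) \<le> 2 * ((L + 1) * (b - a))"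
      using \<open>a \<le> b\<close> by (simp add: m_def algebra_simps)
    then show "exp (m * (b - a)) \<le> (exp ((L + 1) * (b - a)))\<^sup>2"
      by (simp flip: exp_double)
  qed auto
  finally have "(norm (d b))\<^sup>2 \<le> (exp ((L + 1) * (b - a)) * (norm (d a) + \<eta>))\<^sup>2"
    by (simp add: power_mult_distrib mult.commute)
  then show ?thesis
    by (rule power2_le_imp_le) (use \<open>0 \<le> \<eta>\<close> in simp)
qed

text \<open>
  The contribution of the inhomogeneity does not depend on the rate \<open>c\<close>. In the applications \<open>c\<close> is
  of order \<open>1/\<epsilon>\<close>, and this is what makes the bounds on the fast variable uniform in \<open>\<epsilon>\<close>.
\<close>

lemma relaxation_bound:
  fixes u :: "real \<Rightarrow> real"
  assumes der: "\<And>t. t \<in> {a..b} \<Longrightarrow> (u has_real_derivative c * (q t - u t)) (at t within {a..b})"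
    and bound: "\<And>t. t \<in> {a..b} \<Longrightarrow> \<bar>q t\<bar> \<le> H"
    and "0 < c" "a \<le> b"
  shows "\<bar>u b\<bar> \<le> exp (- c * (b - a)) * \<bar>u a\<bar> + H"
proof -
  have upper: "w b \<le> exp (- c * (b - a)) * \<bar>w a\<bar> + H"
    if der': "\<And>t. t \<in> {a..b} \<Longrightarrow> (w has_real_derivative c * (p t - w t)) (at t within {a..b})"
      and bound': "\<And>t. t \<in> {a..b} \<Longrightarrow> p t \<le> H" and "0 \<le> H" for w p
  proof -
    have "(w b - H) * exp (c * (b - a)) \<le> (w a - H) * exp (c * (a - a))"
    proof (rule nonincreasing_within[OF \<open>a \<le> b\<close>, where f = "\<lambda>s. (w s - H) * exp (c * (s - a))"])
      fix t assume t: "t \<in> {a..b}"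
      show "((\<lambda>s. (w s - H) * exp (c * (s - a))) has_real_derivative c * (p t - H) * exp (c * (t - a))) (at t within {a..b})"
        by (rule derivative_eq_intros der'[OF t] refl | simp add: algebra_simps)+
      show "c * (p t - H) * exp (c * (t - a)) \<le> 0"
        using bound'[OF t] \<open>0 < c\<close> by (simp add: mult_nonneg_nonpos mult_nonpos_nonneg)
    qed
    also have "\<dots> \<le> \<bar>w a\<bar>"
      using \<open>0 \<le> H\<close> by simp
    finally have "exp (- c * (b - a)) * ((w b - H) * exp (c * (b - a))) \<le> exp (- c * (b - a)) * \<bar>w a\<bar>"
      by (intro mult_left_mono) auto
    moreover have "exp (- c * (b - a)) * exp (c * (b - a)) = 1"
      by (simp flip: exp_add)
    ultimately show ?thesis
      by (metis (no_types, lifting) add.commute diff_le_eq mult.assoc mult.commute mult.right_neutral)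
  qed
  have H: "0 \<le> H"
    using bound[of a] \<open>a \<le> b\<close> abs_ge_zero[of "q a"] by (meson atLeastAtMost_iff order_refl order_trans)
  have "u b \<le> exp (- c * (b - a)) * \<bar>u a\<bar> + H"
    by (rule upper[OF der _ H]) (use bound in \<open>auto simp: abs_le_iff\<close>)
  moreover have "- u b \<le> exp (- c * (b - a)) * \<bar>- u a\<bar> + H"
  proof (rule upper[OF _ _ H])
    show "((\<lambda>t. - u t) has_real_derivative c * (- q t - (- u t))) (at t within {a..b})" if "t \<in> {a..b}" for t
      using DERIV_minus[OF der[OF that]] by (simp add: algebra_simps)
    show "- q t \<le> H" if "t \<in> {a..b}" for t
      using bound[OF that] by linarith
  qed
  ultimately show ?thesis by simp
qed

lemma has_vector_derivative_vec_iff: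
  fixes f :: "real \<Rightarrow> real ^ 'n::finite"
  shows "(f has_vector_derivative f') (at t within S) \<longleftrightarrow>
    (\<forall>i. ((\<lambda>s. f s $ i) has_real_derivative f' $ i) (at t within S))"
proof -
  have "(\<lambda>x. x * f' $ i) = (*) (f' $ i)" for i
    by (simp add: fun_eq_iff)
  then show ?thesis
    unfolding has_vector_derivative_def has_field_derivative_def
    by (subst has_derivative_componentwise_within) (auto simp: Basis_vec_def inner_axis)
qed

lemma norm_vec_le_card:
  fixes x :: "real ^ 'n::finite"
  assumes "\<And>i. \<bar>x $ i\<bar> \<le> c"
  shows "norm x \<le> real CARD('n) * c"
proof -
  have "norm x \<le> (\<Sum>i\<in>UNIV. \<bar>x $ i\<bar>)" by (rule norm_le_l1_cart)
  also have "\<dots> \<le> (\<Sum>i\<in>(UNIV :: 'n set). c)" by (intro sum_mono assms)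
  finally show ?thesis by simp
qed

section \<open>Initial value problems with a Lipschitz vector field\<close>

lemma ivp_solution_shift:
  assumes "ivp_solution f x0 x" "0 \<le> \<tau>"
  shows "ivp_solution f (x \<tau>) (\<lambda>s. x (s + \<tau>))"
  unfolding ivp_solution_def
proof (intro conjI allI impI)
  show "x (0 + \<tau>) = x \<tau>" by simp
next
  fix t :: real assume "0 \<le> t"
  then have "(x has_vector_derivative f (x (t + \<tau>))) (at (t + \<tau>) within {0..})"
    using assms by (simp add: ivp_solution_def)
  then have "(x has_vector_derivative f (x (t + \<tau>))) (at (t + \<tau>) within (\<lambda>s. s + \<tau>) ` {0..})"
    by (rule has_vector_derivative_within_subset) (use \<open>0 \<le> \<tau>\<close> in auto)
  moreover have "((\<lambda>s. s + \<tau>) has_real_derivative 1) (at t within {0..})"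
    by (auto intro!: derivative_eq_intros)
  ultimately have "(x \<circ> (\<lambda>s. s + \<tau>) has_vector_derivative 1 *\<^sub>R f (x (t + \<tau>))) (at t within {0..})"
    by (intro vector_diff_chain_within) (auto simp: has_real_derivative_iff_has_vector_derivative)
  then show "((\<lambda>s. x (s + \<tau>)) has_vector_derivative f (x (t + \<tau>))) (at t within {0..})"
    by (simp add: o_def)
qed

lemma ivp_solution_derivative_Icc:
  assumes "ivp_solution f x0 x" "0 \<le> a" "t \<in> {a..b}"
  shows "(x has_vector_derivative f (x t)) (at t within {a..b})"
  by (rule has_vector_derivative_within_subset[of x _ t "{0..}"]) (use assms in \<open>auto simp: ivp_solution_def\<close>)

lemma at_within_Icc_Ici:
  fixes t :: real
  assumes "0 \<le> t"
  shows "at t within {0..t + 1} = at t within {0..}"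
  by (rule at_within_nhd[of t "{..<t + 1}"]) auto

text \<open>
  Picard iteration in one step on the whole half-line: in the norm \<open>sup exp(-\<kappa> t) |x(t)|\<close> with
  \<open>\<kappa> > L\<close> the integral operator is a contraction with factor \<open>L/\<kappa>\<close>. The fixed point is sought as
  \<open>z(t) = exp(-\<kappa> t) x(t)\<close> in the space of bounded continuous functions on the real line, all functions
  being extended to negative times by their value at \<open>0\<close>.
\<close>

lemma lipschitz_ivp_exists:
  fixes f :: "'a::banach \<Rightarrow> 'a"
  assumes lip: "\<And>x y. norm (f x - f y) \<le> L * norm (x - y)" and "0 \<le> L"
  shows "\<exists>x. ivp_solution f x0 x"
proof -
  define \<kappa> where "\<kappa> = L + 1"
  have \<kappa>: "0 < \<kappa>" "L / \<kappa> < 1" "0 \<le> L / \<kappa>" using \<open>0 \<le> L\<close> by (auto simp: \<kappa>_def)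
  have exp_integral: "((\<lambda>\<tau>. exp (\<kappa> * \<tau>)) has_integral (exp (\<kappa> * s) - 1) / \<kappa>) {0..s}" if "0 \<le> s" for s
  proof -
    have "((\<lambda>\<tau>. exp (\<kappa> * \<tau>)) has_integral (exp (\<kappa> * s) / \<kappa> - exp (\<kappa> * 0) / \<kappa>)) {0..s}"
    proof (rule fundamental_theorem_of_calculus[OF that])
      fix t show "((\<lambda>\<tau>. exp (\<kappa> * \<tau>) / \<kappa>) has_vector_derivative exp (\<kappa> * t)) (at t within {0..s})"
        unfolding has_real_derivative_iff_has_vector_derivative[symmetric]
        using \<kappa> by (auto intro!: derivative_eq_intros)
    qed
    then show ?thesis by (simp add: diff_divide_distrib)
  qed
  have contf: "continuous_on UNIV f"
    by (rule lipschitz_on_continuous_on[of L])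
       (use assms in \<open>auto simp: lipschitz_on_def dist_norm\<close>)
  define X where "X = (\<lambda>z :: real \<Rightarrow> 'a. \<lambda>s. f (exp (\<kappa> * s) *\<^sub>R z s))"
  have contX: "continuous_on S (X (apply_bcontfun z))" for z S
  proof -
    have "continuous_on S (apply_bcontfun z)" by (rule continuous_on_subset[of UNIV]) auto
    then show ?thesis
      unfolding X_def
      by (intro continuous_on_compose2[OF contf] continuous_intros) auto
  qed
  have intX: "X (apply_bcontfun z) integrable_on {0..s}" for z s
    by (rule integrable_continuous_real[OF contX])
  have weighted: "norm (integral {0..s} k) \<le> c / \<kappa> * exp (\<kappa> * s)"
    if "k integrable_on {0..s}" "\<And>\<tau>. \<tau> \<in> {0..s} \<Longrightarrow> norm (k \<tau>) \<le> c * exp (\<kappa> * \<tau>)" "0 \<le> s" "0 \<le> c"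
    for k :: "real \<Rightarrow> 'a" and c s
  proof -
    have "norm (integral {0..s} k) \<le> integral {0..s} (\<lambda>\<tau>. c * exp (\<kappa> * \<tau>))"
      by (rule integral_norm_bound_integral)
         (use that has_integral_mult_right[OF exp_integral[OF \<open>0 \<le> s\<close>], of c] in \<open>auto dest: has_integral_integrable\<close>)
    also have "\<dots> = c * ((exp (\<kappa> * s) - 1) / \<kappa>)"
      using has_integral_mult_right[OF exp_integral[OF \<open>0 \<le> s\<close>], of c] by (rule integral_unique)
    also have "\<dots> \<le> c / \<kappa> * exp (\<kappa> * s)"
      using \<kappa> \<open>0 \<le> c\<close> by (simp add: field_simps)
    finally show ?thesis .
  qed
  have unweight: "norm (exp (- \<kappa> * s) *\<^sub>R y) \<le> c" if "norm y \<le> c * exp (\<kappa> * s)" for y :: 'a and c s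
  proof -
    have "exp (- \<kappa> * s) * norm y \<le> exp (- \<kappa> * s) * (c * exp (\<kappa> * s))"
      using that by (intro mult_left_mono) auto
    also have "\<dots> = c * exp (- \<kappa> * s + \<kappa> * s)"
      by (simp only: exp_add mult_ac)
    finally show ?thesis by simp
  qed
  define I where "I = (\<lambda>z s. x0 + integral {0..s} (X (apply_bcontfun z)))"
  define T where "T = (\<lambda>z t. exp (- \<kappa> * max 0 t) *\<^sub>R I z (max 0 t))"
  have T_bcont: "T z \<in> bcontfun" for z
  proof (rule bcontfun_normI)
    have "continuous_on {0..} (\<lambda>s. integral {0..s} (X (apply_bcontfun z)))"
    proof (rule continuous_on_vector_derivative)
      fix t :: real assume "t \<in> {0..}"
      have "((\<lambda>s. integral {0..s} (X (apply_bcontfun z))) has_vector_derivative X z t) (at t within {0..t+1})"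
        by (rule integral_has_vector_derivative) (use contX \<open>t \<in> {0..}\<close> in auto)
      then show "((\<lambda>s. integral {0..s} (X (apply_bcontfun z))) has_vector_derivative X z t) (at t within {0..})"
        using \<open>t \<in> {0..}\<close> by (simp add: at_within_Icc_Ici)
    qed
    then have "continuous_on UNIV (\<lambda>t. integral {0..max 0 t} (X (apply_bcontfun z)))"
      by (rule continuous_on_compose2) (auto intro!: continuous_intros)
    then show "continuous_on UNIV (T z)"
      unfolding T_def I_def by (intro continuous_intros)
    fix t :: real
    define s where "s = max 0 t"
    have s: "0 \<le> s" by (simp add: s_def)
    define c where "c = norm (f 0) + L * norm z"
    have "norm (integral {0..s} (X (apply_bcontfun z))) \<le> c / \<kappa> * exp (\<kappa> * s)"
    proof (rule weighted[OF intX _ s])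
      show "0 \<le> c" using \<open>0 \<le> L\<close> by (simp add: c_def)
      fix \<tau> assume \<tau>: "\<tau> \<in> {0..s}"
      have "norm (X z \<tau>) \<le> norm (f 0) + L * norm (exp (\<kappa> * \<tau>) *\<^sub>R z \<tau>)"
        using norm_triangle_sub[of "X z \<tau>" "f 0"] lip[of "exp (\<kappa> * \<tau>) *\<^sub>R z \<tau>" 0] by (simp add: X_def)
      also have "\<dots> \<le> norm (f 0) * exp (\<kappa> * \<tau>) + L * (exp (\<kappa> * \<tau>) * norm z)"
        using \<tau> \<kappa> \<open>0 \<le> L\<close> norm_bounded[of z \<tau>]
        by (intro add_mono mult_left_mono) (auto simp: mult_le_cancel_left1)
      finally show "norm (X z \<tau>) \<le> c * exp (\<kappa> * \<tau>)" by (simp add: c_def algebra_simps)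
    qed
    then have "norm (I z s) \<le> norm x0 + c / \<kappa> * exp (\<kappa> * s)"
      unfolding I_def by (intro norm_triangle_le) simp
    also have "\<dots> \<le> norm x0 * exp (\<kappa> * s) + c / \<kappa> * exp (\<kappa> * s)"
      using s \<kappa> by (auto simp: mult_le_cancel_left1)
    finally show "norm (T z t) \<le> norm x0 + c / \<kappa>"
      using unweight[of "I z s" "norm x0 + c / \<kappa>" s] by (simp add: T_def s_def[symmetric] algebra_simps)
  qed
  define S where "S = (\<lambda>z. Bcontfun (T z))"
  have S: "apply_bcontfun (S z) = T z" for z
    unfolding S_def using T_bcont by (rule Bcontfun_inverse)
  have "\<exists>!z. S z = z"
  proof (rule banach_fix_type[OF \<kappa>(3,2)], intro allI)
    fix z w
    show "dist (S z) (S w) \<le> L / \<kappa> * dist z w"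
    proof (rule dist_bound)
      fix t :: real
      define s where "s = max 0 t"
      have s: "0 \<le> s" by (simp add: s_def)
      have "I z s - I w s = integral {0..s} (\<lambda>\<tau>. X z \<tau> - X w \<tau>)"
        unfolding I_def by (simp add: integral_diff[OF intX intX])
      also have "norm \<dots> \<le> L * dist z w / \<kappa> * exp (\<kappa> * s)"
      proof (rule weighted[OF integrable_diff[OF intX intX] _ s])
        fix \<tau>
        have "norm (X z \<tau> - X w \<tau>) \<le> L * norm (exp (\<kappa> * \<tau>) *\<^sub>R (z \<tau> - w \<tau>))"
          using lip by (simp add: X_def scaleR_diff_right)
        also have "\<dots> \<le> L * (exp (\<kappa> * \<tau>) * dist z w)"
          using dist_bounded[of z \<tau> w] \<open>0 \<le> L\<close> by (auto intro!: mult_left_mono simp: dist_norm)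
        finally show "norm (X z \<tau> - X w \<tau>) \<le> L * dist z w * exp (\<kappa> * \<tau>)" by (simp add: mult_ac)
      qed (use \<open>0 \<le> L\<close> in simp)
      finally have "norm (I z s - I w s) \<le> L / \<kappa> * dist z w * exp (\<kappa> * s)" by simp
      then show "dist (S z t) (S w t) \<le> L / \<kappa> * dist z w"
        using unweight[of "I z s - I w s"] by (simp add: S T_def s_def[symmetric] dist_norm scaleR_diff_right)
    qed
  qed
  then obtain z where z: "S z = z" by blast
  define x where "x = (\<lambda>t. exp (\<kappa> * t) *\<^sub>R z t)"
  have x: "x t = x0 + integral {0..t} (\<lambda>s. f (x s))" if "0 \<le> t" for t
  proof -
    have "z t = T z t" using S[of z] z by simp
    then have "z t = exp (- \<kappa> * t) *\<^sub>R I z t" using that by (simp add: T_def)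
    then have "x t = I z t" by (simp add: x_def flip: exp_add)
    then show ?thesis by (simp add: I_def X_def x_def)
  qed
  have contx: "continuous_on S (\<lambda>s. f (x s))" for S
    using contX[of S z] by (simp add: X_def x_def)
  have "ivp_solution f x0 x"
    unfolding ivp_solution_def
  proof (intro conjI allI impI)
    show "x 0 = x0" using x[of 0] by simp
    fix t :: real assume t: "0 \<le> t"
    have "((\<lambda>t. integral {0..t} (\<lambda>s. f (x s))) has_vector_derivative f (x t)) (at t within {0..t+1})"
      by (rule integral_has_vector_derivative[OF contx]) (use t in auto)
    then have "((\<lambda>t. integral {0..t} (\<lambda>s. f (x s))) has_vector_derivative f (x t)) (at t within {0..})"
      using \<open>0 \<le> t\<close> by (simp add: at_within_Icc_Ici)
    then have "((\<lambda>t. x0 + integral {0..t} (\<lambda>s. f (x s))) has_vector_derivative f (x t)) (at t within {0..})"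
      by (auto intro!: derivative_eq_intros)
    then show "(x has_vector_derivative f (x t)) (at t within {0..})"
      by (rule has_vector_derivative_transform[rotated 2]) (use t x in auto)
  qed
  then show ?thesis by blast
qed

lemma lipschitz_ivp_unique:
  fixes f :: "'a::real_inner \<Rightarrow> 'a"
  assumes lip: "\<And>x y. norm (f x - f y) \<le> L * norm (x - y)" and "0 \<le> L"
    and x: "ivp_solution f x0 x" and y: "ivp_solution f x0 y" and "0 \<le> t"
  shows "x t = y t"
proof -
  have "norm (x t - y t) \<le> exp ((L + 1) * (t - 0)) * (norm (x 0 - y 0) + 0)"
  proof (rule gronwall_norm)
    fix s assume "s \<in> {0..t}"
    then show "((\<lambda>s. x s - y s) has_vector_derivative f (x s) - f (y s)) (at s within {0..t})"
      using x y by (intro has_vector_derivative_diff ivp_solution_derivative_Icc) auto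
  qed (use lip \<open>0 \<le> L\<close> \<open>0 \<le> t\<close> in auto)
  then show ?thesis using x y by (simp add: ivp_solution_def)
qed

section \<open>Exponential convergence to zero\<close>

text \<open>
  On the initial segment \<open>[0, a]\<close> a bound of exponential form holds by compactness, with a constant
  enlarged by \<open>exp(c a)\<close>.
\<close>

lemma converges_exponentially_from:
  fixes f :: "real \<Rightarrow> 'a::real_normed_vector"
  assumes "continuous_on {0..} f" "0 < c" "0 \<le> a"
    and tail: "\<And>t. a \<le> t \<Longrightarrow> norm (f t) \<le> C * exp (- c * (t - a))"
  shows "converges_exponentially_to_zero f"
proof -
  have "compact (f ` {0..a})"
    by (intro compact_continuous_image continuous_on_subset[OF assms(1)]) auto
  then obtain M where M: "\<And>t. t \<in> {0..a} \<Longrightarrow> norm (f t) \<le> M"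
    by (meson bounded_iff compact_imp_bounded imageI)
  define K where "K = max \<bar>C\<bar> \<bar>M\<bar> * exp (c * a)"
  have "norm (f t) \<le> K * exp (- c * t)" if "0 \<le> t" for t
  proof (cases "t \<le> a")
    case True
    have "norm (f t) \<le> max \<bar>C\<bar> \<bar>M\<bar> * 1"
      using M[of t] True that by auto
    also have "\<dots> \<le> max \<bar>C\<bar> \<bar>M\<bar> * exp (c * a + (- c * t))"
      using True \<open>0 < c\<close> by (intro mult_left_mono) (auto simp: algebra_simps)
    finally show ?thesis by (simp only: K_def exp_add mult.assoc)
  next
    case False
    have "norm (f t) \<le> C * exp (- c * (t - a))" using tail False by simp
    also have "\<dots> \<le> max \<bar>C\<bar> \<bar>M\<bar> * exp (c * a + (- c * t))"
      by (intro mult_mono) (auto simp: algebra_simps)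
    finally show ?thesis by (simp only: K_def exp_add mult.assoc)
  qed
  then show ?thesis
    unfolding converges_exponentially_to_zero_def using \<open>0 < c\<close> by blast
qed

lemma converges_exponentially_from_grid:
  fixes f :: "real \<Rightarrow> 'a::real_normed_vector"
  assumes "continuous_on {0..} f" "0 < T" "0 \<le> a" "0 < q" "q < 1"
    and grid: "\<And>n t. t \<in> {a + real n * T..a + real n * T + T} \<Longrightarrow> norm (f t) \<le> C * q ^ n"
  shows "converges_exponentially_to_zero f"
proof (rule converges_exponentially_from[OF assms(1) _ \<open>0 \<le> a\<close>, of "- ln q / T" "C / q"])
  show "0 < - ln q / T" using assms by (simp add: divide_neg_pos)
  have C: "0 \<le> C" using order_trans[OF norm_ge_zero grid[of a 0]] \<open>0 < T\<close> by simp
  fix t assume "a \<le> t"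
  define n where "n = nat \<lfloor>(t - a) / T\<rfloor>"
  have n: "real n \<le> (t - a) / T" "(t - a) / T \<le> real n + 1"
    using \<open>a \<le> t\<close> \<open>0 < T\<close> by (auto simp: n_def)
  have "norm (f t) \<le> C * q ^ n"
    by (rule grid) (use n \<open>0 < T\<close> in \<open>auto simp: field_simps\<close>)
  also have "q ^ n = q powr real n" using \<open>0 < q\<close> by (simp add: powr_realpow)
  also have "\<dots> \<le> q powr ((t - a) / T - 1)"
    using n assms by (intro powr_mono') auto
  also have "\<dots> = q powr ((t - a) / T) / q"
    using \<open>0 < q\<close> by (simp add: powr_diff)
  also have "q powr ((t - a) / T) = exp (ln q * ((t - a) / T))"
    using \<open>0 < q\<close> by (simp add: powr_def)
  finally show "norm (f t) \<le> C / q * exp (- (- ln q / T) * (t - a))"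
    using C by (simp add: mult_left_mono)
qed

lemma converges_exponentially_lipschitz:
  assumes "converges_exponentially_to_zero f" "\<And>t. 0 \<le> t \<Longrightarrow> norm (g t) \<le> K * norm (f t)"
  shows "converges_exponentially_to_zero g"
proof -
  obtain C c where c: "0 < c" and f: "\<And>t. 0 \<le> t \<Longrightarrow> norm (f t) \<le> C * exp (- c * t)"
    using assms(1) unfolding converges_exponentially_to_zero_def by blast
  have "norm (g t) \<le> \<bar>K\<bar> * C * exp (- c * t)" if "0 \<le> t" for t
  proof -
    have "norm (g t) \<le> \<bar>K\<bar> * norm (f t)"
      using assms(2)[OF that] mult_right_mono[OF abs_ge_self, of "norm (f t)" K] by simp
    also have "\<dots> \<le> \<bar>K\<bar> * (C * exp (- c * t))"
      by (intro mult_left_mono f that) auto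
    finally show ?thesis by simp
  qed
  then show ?thesis
    unfolding converges_exponentially_to_zero_def using c by blast
qed

lemma converges_exponentially_diff:
  assumes "converges_exponentially_to_zero f" "converges_exponentially_to_zero g"
  shows "converges_exponentially_to_zero (\<lambda>t. f t - g t)"
proof -
  obtain C c where c: "0 < c" and f: "\<And>t. 0 \<le> t \<Longrightarrow> norm (f t) \<le> C * exp (- c * t)"
    using assms(1) unfolding converges_exponentially_to_zero_def by blast
  obtain D d where d: "0 < d" and g: "\<And>t. 0 \<le> t \<Longrightarrow> norm (g t) \<le> D * exp (- d * t)"
    using assms(2) unfolding converges_exponentially_to_zero_def by blast
  have "norm (f t - g t) \<le> (\<bar>C\<bar> + \<bar>D\<bar>) * exp (- min c d * t)" if "0 \<le> t" for t
  proof -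
    have "norm (f t - g t) \<le> C * exp (- c * t) + D * exp (- d * t)"
      using f[OF that] g[OF that] norm_triangle_ineq4[of "f t" "g t"] by linarith
    also have "\<dots> \<le> \<bar>C\<bar> * exp (- min c d * t) + \<bar>D\<bar> * exp (- min c d * t)"
      using that by (intro add_mono mult_mono) (auto intro!: mult_right_mono)
    finally show ?thesis by (simp add: algebra_simps)
  qed
  then show ?thesis
    unfolding converges_exponentially_to_zero_def using c d by (intro exI[of _ "\<bar>C\<bar> + \<bar>D\<bar>"] exI[of _ "min c d"]) auto
qed

section \<open>Perturbations of an exponentially stable equation\<close>

text \<open>
  Ordinary differentiability only compares \<open>f y\<close> with \<open>f x\<close>; comparing two solutions that both move
  near the fixed point needs the estimate for pairs of nearby points.
\<close>

definition strictly_differentiable :: "('a::real_normed_vector \<Rightarrow> 'b::real_normed_vector) \<Rightarrow> ('a \<Rightarrow> 'b) \<Rightarrow> 'a \<Rightarrow> bool" where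
  "strictly_differentiable f A x \<longleftrightarrow> bounded_linear A \<and>
     (\<forall>e>0. \<exists>\<rho>>0. \<forall>y\<in>cball x \<rho>. \<forall>z\<in>cball x \<rho>. norm (f y - f z - A (y - z)) \<le> e * norm (y - z))"

locale stable_ode =
  fixes g :: "'a::euclidean_space \<Rightarrow> 'a" and L :: real and xs :: 'a and A :: "'a \<Rightarrow> 'a"
  assumes L: "0 \<le> L" and lip: "norm (g x - g y) \<le> L * norm (x - y)"
    and strict: "strictly_differentiable g A xs"
    and stable: "exponentially_stable_fixed_point g xs"
begin

lemma deviation_growth:
  assumes x: "\<And>t. t \<in> {a..b} \<Longrightarrow> (x has_vector_derivative g (x t)) (at t within {a..b})"
    and w: "\<And>t. t \<in> {a..b} \<Longrightarrow> (w has_vector_derivative w' t) (at t within {a..b})"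
    and p: "\<And>t. t \<in> {a..b} \<Longrightarrow> norm (w' t - g (w t)) \<le> \<eta>"
    and "0 \<le> \<eta>" "a \<le> b"
  shows "norm (w b - x b) \<le> exp ((L + 1) * (b - a)) * (norm (w a - x a) + \<eta>)"
proof (rule gronwall_norm[where d' = "\<lambda>t. w' t - g (x t)"])
  fix t assume t: "t \<in> {a..b}"
  show "((\<lambda>t. w t - x t) has_vector_derivative w' t - g (x t)) (at t within {a..b})"
    by (intro has_vector_derivative_diff x w t)
  have "norm (w' t - g (x t)) \<le> norm (w' t - g (w t)) + norm (g (w t) - g (x t))"
    using norm_triangle_ineq[of "w' t - g (w t)" "g (w t) - g (x t)"] by simp
  then show "norm (w' t - g (x t)) \<le> L * norm (w t - x t) + \<eta>"
    using p[OF t] lip[of "w t" "x t"] by linarith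
qed (use L \<open>0 \<le> \<eta>\<close> \<open>a \<le> b\<close> in auto)

lemma fixed_point: "g xs = 0"
  using stable by (simp add: exponentially_stable_fixed_point_def)

lemma stability_constants:
  obtains r k c where "r > 0" "k > 0" "c > 0"
    "\<And>x0. norm (x0 - xs) < r \<Longrightarrow> \<exists>x. ivp_solution g x0 x"
    "\<And>x0 x t. norm (x0 - xs) < r \<Longrightarrow> ivp_solution g x0 x \<Longrightarrow> 0 \<le> t \<Longrightarrow>
       norm (x t - xs) \<le> k * norm (x0 - xs) * exp (- c * t)"
  using stable unfolding exponentially_stable_fixed_point_def by blast

text \<open>
  Exponential stability speaks about the distance to the fixed point, whereas here the distance of
  two moving curves has to shrink. Linearisation turns one into the other: for \<open>x\<close> and \<open>w\<close> near \<open>xs\<close>,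
  the difference \<open>w - x\<close> almost solves the linear equation \<open>d' = A d\<close>, and so does the rescaled
  difference \<open>\<xi> = s (u - xs)\<close> for the true solution \<open>u\<close> with \<open>\<xi>(a) = w(a) - x(a)\<close>. The scaling
  \<open>s\<close> is chosen such that \<open>u\<close> starts at a fixed small distance \<open>\<sigma>\<close> from \<open>xs\<close>. By stability \<open>\<xi>\<close>
  decays to a quarter of its size within the time \<open>T\<close>, and Gronwall's inequality bounds the
  distance of the two by another quarter plus a multiple of \<open>\<eta>\<close>.
\<close>

lemma local_contraction:
  obtains T C \<rho> where "0 < T" "0 < C" "0 < \<rho>"
    "\<And>a x w w' \<eta>. 0 \<le> \<eta> \<Longrightarrow>
      (\<And>t. t \<in> {a..a+T} \<Longrightarrow> (x has_vector_derivative g (x t)) (at t within {a..a+T})) \<Longrightarrow>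
      (\<And>t. t \<in> {a..a+T} \<Longrightarrow> (w has_vector_derivative w' t) (at t within {a..a+T})) \<Longrightarrow>
      (\<And>t. t \<in> {a..a+T} \<Longrightarrow> norm (w' t - g (w t)) \<le> \<eta>) \<Longrightarrow>
      (\<And>t. t \<in> {a..a+T} \<Longrightarrow> norm (x t - xs) \<le> \<rho> \<and> norm (w t - xs) \<le> \<rho>) \<Longrightarrow>
      norm (w (a + T) - x (a + T)) \<le> norm (w a - x a) / 2 + C * \<eta>"
proof -
  obtain r k c where r: "r > 0" and k: "k > 0" and c: "c > 0"
    and ex: "\<And>x0. norm (x0 - xs) < r \<Longrightarrow> \<exists>x. ivp_solution g x0 x"
    and dec: "\<And>x0 x t. norm (x0 - xs) < r \<Longrightarrow> ivp_solution g x0 x \<Longrightarrow> 0 \<le> t \<Longrightarrow>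
       norm (x t - xs) \<le> k * norm (x0 - xs) * exp (- c * t)"
    by (fact stability_constants)
  have A: "bounded_linear A"
    using strict by (simp add: strictly_differentiable_def)
  obtain KA where KA: "0 < KA" "\<And>x. norm (A x) \<le> norm x * KA"
    using bounded_linear.pos_bounded[OF A] by blast
  define T where "T = ln (4 * k + 4) / c"
  have T: "0 < T" using k c by (simp add: T_def)
  have decT: "k * exp (- c * T) \<le> 1 / 4"
  proof -
    have "exp (c * T) = 4 * k + 4" using c k by (simp add: T_def)
    then show ?thesis using k by (simp add: exp_minus field_simps)
  qed
  define G where "G = exp ((KA + 1 + 1) * T)"
  have G: "0 < G" by (simp add: G_def)
  \<comment> \<open>The linearisation error \<open>2 e k\<close>, amplified by the growth factor \<open>G\<close> of the window, must stay below 1/4.\<close>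
  define e where "e = min 1 (1 / (8 * k * G))"
  have e: "0 < e" "e \<le> 1" "2 * e * k * G \<le> 1 / 4"
    using k G by (auto simp: e_def min_def field_simps)
  obtain \<rho> where \<rho>: "0 < \<rho>" and strict_\<rho>:
    "\<And>y z. norm (y - xs) \<le> \<rho> \<Longrightarrow> norm (z - xs) \<le> \<rho> \<Longrightarrow> norm (g y - g z - A (y - z)) \<le> e * norm (y - z)"
    using strict e(1) unfolding strictly_differentiable_def
    by (metis dist_norm mem_cball norm_minus_commute)
  define \<sigma> where "\<sigma> = min (r / 2) (\<rho> / k)"
  have \<sigma>: "0 < \<sigma>" "\<sigma> < r" "k * \<sigma> \<le> \<rho>"
    using r \<rho> k by (auto simp: \<sigma>_def min_def field_simps)
  show thesis
  proof (rule that[OF T _ \<rho>, of "max G (exp ((L + 1) * T))"])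
    show "0 < max G (exp ((L + 1) * T))" using G by simp
    fix a x w w' and \<eta> :: real
    assume \<eta>: "0 \<le> \<eta>"
      and x: "\<And>t. t \<in> {a..a+T} \<Longrightarrow> (x has_vector_derivative g (x t)) (at t within {a..a+T})"
      and w: "\<And>t. t \<in> {a..a+T} \<Longrightarrow> (w has_vector_derivative w' t) (at t within {a..a+T})"
      and p: "\<And>t. t \<in> {a..a+T} \<Longrightarrow> norm (w' t - g (w t)) \<le> \<eta>"
      and near: "\<And>t. t \<in> {a..a+T} \<Longrightarrow> norm (x t - xs) \<le> \<rho> \<and> norm (w t - xs) \<le> \<rho>"
    define d0 where "d0 = w a - x a"
    show "norm (w (a + T) - x (a + T)) \<le> norm (w a - x a) / 2 + max G (exp ((L + 1) * T)) * \<eta>"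
    proof (cases "d0 = 0")
      case True
      have "norm (w (a + T) - x (a + T)) \<le> exp ((L + 1) * (a + T - a)) * (norm (w a - x a) + \<eta>)"
        by (rule deviation_growth[OF x w p \<eta>]) (use T in auto)
      also have "\<dots> \<le> max G (exp ((L + 1) * T)) * \<eta>"
        using True \<eta> by (auto simp: d0_def intro!: mult_right_mono)
      finally show ?thesis by (smt (verit) norm_ge_zero divide_nonneg_pos)
    next
      case False
      define s where "s = norm d0 / \<sigma>"
      have s: "0 < s" using False \<sigma> by (simp add: s_def)
      define u0 where "u0 = xs + (1 / s) *\<^sub>R d0"
      have u0: "norm (u0 - xs) = \<sigma>"
        using False \<sigma> by (simp add: u0_def s_def)
      obtain u where u: "ivp_solution g u0 u"
        using ex[of u0] u0 \<sigma> by auto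
      have udec: "norm (u t - xs) \<le> k * \<sigma> * exp (- c * t)" if "0 \<le> t" for t
        using dec[OF _ u that] u0 \<sigma> by simp
      have usmall: "norm (u t - xs) \<le> k * \<sigma>" if "0 \<le> t" for t
      proof -
        have "exp (- c * t) \<le> 1" using that c by simp
        then have "k * \<sigma> * exp (- c * t) \<le> k * \<sigma> * 1"
          using k \<sigma> by (intro mult_left_mono) auto
        then show ?thesis using udec[OF that] by simp
      qed
      define \<xi> where "\<xi> = (\<lambda>t. s *\<^sub>R (u (t - a) - xs))"
      have \<xi>_small: "norm (\<xi> t) \<le> k * norm d0" if "a \<le> t" for t
      proof -
        have "norm (\<xi> t) \<le> s * (k * \<sigma>)"
          using usmall[of "t - a"] that s by (simp add: \<xi>_def)
        then show ?thesis using \<sigma> by (simp add: s_def mult.commute)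
      qed
      have \<xi>_T: "norm (\<xi> (a + T)) \<le> norm d0 / 4"
      proof -
        have "norm (\<xi> (a + T)) \<le> s * (k * \<sigma> * exp (- c * T))"
          using udec[of T] T s by (simp add: \<xi>_def)
        also have "\<dots> = norm d0 * (k * exp (- c * T))"
          using \<sigma> by (simp add: s_def)
        also have "\<dots> \<le> norm d0 * (1 / 4)"
          by (intro mult_left_mono decT) auto
        finally show ?thesis by simp
      qed
      have \<xi>_der: "(\<xi> has_vector_derivative s *\<^sub>R g (u (t - a))) (at t within {a..a+T})" if "t \<in> {a..a+T}" for t
      proof -
        have "(u has_vector_derivative g (u (t - a))) (at (t - a) within (\<lambda>t. t - a) ` {a..a+T})"
          by (rule has_vector_derivative_within_subset[of _ _ _ "{0..}"]) (use u that in \<open>auto simp: ivp_solution_def\<close>)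
        moreover have "((\<lambda>t. t - a) has_vector_derivative 1) (at t within {a..a+T})"
          by (auto intro!: derivative_eq_intros)
        ultimately have "(u \<circ> (\<lambda>t. t - a) has_vector_derivative 1 *\<^sub>R g (u (t - a))) (at t within {a..a+T})"
          by (intro vector_diff_chain_within)
        then show ?thesis
          unfolding \<xi>_def o_def by (auto intro!: derivative_eq_intros)
      qed
      have \<xi>_lin: "norm (s *\<^sub>R g (u (t - a)) - A (\<xi> t)) \<le> e * norm (\<xi> t)" if "a \<le> t" for t
      proof -
        have "norm (g (u (t - a)) - g xs - A (u (t - a) - xs)) \<le> e * norm (u (t - a) - xs)"
          using usmall[of "t - a"] that \<sigma> \<rho> by (intro strict_\<rho>) auto
        then have "s * norm (g (u (t - a)) - A (u (t - a) - xs)) \<le> s * (e * norm (u (t - a) - xs))"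
          using s by (simp add: fixed_point)
        moreover have "s *\<^sub>R g (u (t - a)) - A (\<xi> t) = s *\<^sub>R (g (u (t - a)) - A (u (t - a) - xs))"
          unfolding \<xi>_def linear_cmul[OF bounded_linear.linear[OF A]] by (rule scaleR_diff_right[symmetric])
        ultimately show ?thesis using s by (simp add: \<xi>_def)
      qed
      define q where "q = (\<lambda>t. w t - x t - \<xi> t)"
      have \<xi>_a: "\<xi> a = d0"
        using s u by (simp add: \<xi>_def ivp_solution_def u0_def)
      have "norm (q (a + T)) \<le> exp ((KA + 1 + 1) * (a + T - a)) * (norm (q a) + (2 * e * k * norm d0 + \<eta>))"
      proof (rule gronwall_norm[where d' = "\<lambda>t. w' t - g (x t) - s *\<^sub>R g (u (t - a))"])
        fix t assume t: "t \<in> {a..a+T}"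
        show "(q has_vector_derivative w' t - g (x t) - s *\<^sub>R g (u (t - a))) (at t within {a..a+T})"
          unfolding q_def by (intro has_vector_derivative_diff x w \<xi>_der t)
        have eq: "w' t - g (x t) - s *\<^sub>R g (u (t - a)) =
            A (q t) + (w' t - g (w t)) + (g (w t) - g (x t) - A (w t - x t)) - (s *\<^sub>R g (u (t - a)) - A (\<xi> t))"
          by (simp add: q_def linear_diff[OF bounded_linear.linear[OF A]] linear_add[OF bounded_linear.linear[OF A]] algebra_simps)
        have "norm (w' t - g (x t) - s *\<^sub>R g (u (t - a)))
            \<le> norm (A (q t)) + norm (w' t - g (w t)) + norm (g (w t) - g (x t) - A (w t - x t))
              + norm (s *\<^sub>R g (u (t - a)) - A (\<xi> t))"
          unfolding eq by (smt (verit) norm_triangle_ineq norm_triangle_ineq4)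
        also have "\<dots> \<le> norm (q t) * KA + \<eta> + e * norm (w t - x t) + e * norm (\<xi> t)"
          using KA(2)[of "q t"] p[OF t] near[OF t] strict_\<rho>[of "w t" "x t"] \<xi>_lin[of t] t
          by (intro add_mono) auto
        also have "e * norm (w t - x t) \<le> e * (norm (q t) + norm (\<xi> t))"
          using e norm_triangle_ineq[of "q t" "\<xi> t"] by (intro mult_left_mono) (auto simp: q_def)
        also have "norm (q t) * KA + \<eta> + e * (norm (q t) + norm (\<xi> t)) + e * norm (\<xi> t)
            = KA * norm (q t) + e * norm (q t) + 2 * e * norm (\<xi> t) + \<eta>"
          by (simp add: algebra_simps)
        also have "\<dots> \<le> KA * norm (q t) + 1 * norm (q t) + 2 * e * (k * norm d0) + \<eta>"
          using e \<xi>_small[of t] t by (intro add_mono mult_right_mono mult_left_mono) auto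
        finally show "norm (w' t - g (x t) - s *\<^sub>R g (u (t - a))) \<le> (KA + 1) * norm (q t) + (2 * e * k * norm d0 + \<eta>)"
          by (simp add: algebra_simps)
      qed (use KA T e k \<eta> in auto)
      then have "norm (q (a + T)) \<le> G * (2 * e * k * norm d0 + \<eta>)"
        by (simp add: G_def q_def \<xi>_a d0_def)
      also have "\<dots> = 2 * e * k * G * norm d0 + G * \<eta>"
        by (simp add: algebra_simps)
      also have "\<dots> \<le> 1 / 4 * norm d0 + max G (exp ((L + 1) * T)) * \<eta>"
        using e \<eta> by (intro add_mono mult_right_mono) auto
      finally have "norm (q (a + T)) \<le> norm d0 / 4 + max G (exp ((L + 1) * T)) * \<eta>" by simp
      moreover have "norm (w (a + T) - x (a + T)) \<le> norm (q (a + T)) + norm (\<xi> (a + T))"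
        using norm_triangle_ineq[of "q (a + T)" "\<xi> (a + T)"] by (simp add: q_def)
      ultimately show ?thesis using \<xi>_T by (simp add: d0_def)
    qed
  qed
qed

text \<open>
  Because of the halving, the errors at the grid points \<open>a + n T\<close> stay below \<open>\<alpha> + 2 C \<eta>\<close>. The
  induction carries along that \<open>w\<close> remains in the neighbourhood in which the contraction holds: \<open>x\<close>
  uses up only half of the radius, and \<open>\<eta>0\<close> is chosen such that the error fits into the other half.
\<close>

lemma local_tracking:
  obtains C \<rho> \<eta>0 where "0 < C" "0 < \<rho>" "0 < \<eta>0"
    "\<And>a x w w' \<eta> \<alpha> t. 0 \<le> \<eta> \<Longrightarrow> \<eta> \<le> \<eta>0 \<Longrightarrow> \<alpha> \<le> \<eta>0 \<Longrightarrow> norm (w a - x a) \<le> \<alpha> \<Longrightarrow>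
      (\<And>t. a \<le> t \<Longrightarrow> (x has_vector_derivative g (x t)) (at t within {a..})) \<Longrightarrow>
      (\<And>t. a \<le> t \<Longrightarrow> (w has_vector_derivative w' t) (at t within {a..})) \<Longrightarrow>
      (\<And>t. a \<le> t \<Longrightarrow> norm (w' t - g (w t)) \<le> \<eta>) \<Longrightarrow>
      (\<And>t. a \<le> t \<Longrightarrow> norm (x t - xs) \<le> \<rho>) \<Longrightarrow>
      a \<le> t \<Longrightarrow> norm (w t - x t) \<le> C * (\<alpha> + \<eta>)"
proof -
  obtain T C \<rho> where T: "0 < T" and C: "0 < C" and \<rho>: "0 < \<rho>" and step:
    "\<And>a x w w' \<eta>. 0 \<le> \<eta> \<Longrightarrow>
      (\<And>t. t \<in> {a..a+T} \<Longrightarrow> (x has_vector_derivative g (x t)) (at t within {a..a+T})) \<Longrightarrow>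
      (\<And>t. t \<in> {a..a+T} \<Longrightarrow> (w has_vector_derivative w' t) (at t within {a..a+T})) \<Longrightarrow>
      (\<And>t. t \<in> {a..a+T} \<Longrightarrow> norm (w' t - g (w t)) \<le> \<eta>) \<Longrightarrow>
      (\<And>t. t \<in> {a..a+T} \<Longrightarrow> norm (x t - xs) \<le> \<rho> \<and> norm (w t - xs) \<le> \<rho>) \<Longrightarrow>
      norm (w (a + T) - x (a + T)) \<le> norm (w a - x a) / 2 + C * \<eta>"
    by (fact local_contraction)
  define G where "G = exp ((L + 1) * T)"
  have G: "0 < G" by (simp add: G_def)
  define C' where "C' = G * (2 * C + 1)"
  have C': "0 < C'" using G C by (simp add: C'_def)
  define \<eta>0 where "\<eta>0 = \<rho> / (4 * C')"
  have \<eta>0: "0 < \<eta>0" using C' \<rho> by (simp add: \<eta>0_def)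
  show thesis
  proof (rule that[OF C' _ \<eta>0, of "\<rho> / 2"])
    show "0 < \<rho> / 2" using \<rho> by simp
    fix a x w w' \<eta> \<alpha> and t :: real
    assume \<eta>: "0 \<le> \<eta>" "\<eta> \<le> \<eta>0" and \<alpha>: "\<alpha> \<le> \<eta>0" and init: "norm (w a - x a) \<le> \<alpha>"
      and x: "\<And>t. a \<le> t \<Longrightarrow> (x has_vector_derivative g (x t)) (at t within {a..})"
      and w: "\<And>t. a \<le> t \<Longrightarrow> (w has_vector_derivative w' t) (at t within {a..})"
      and p: "\<And>t. a \<le> t \<Longrightarrow> norm (w' t - g (w t)) \<le> \<eta>"
      and near: "\<And>t. a \<le> t \<Longrightarrow> norm (x t - xs) \<le> \<rho> / 2"
      and "a \<le> t"
    have \<alpha>0: "0 \<le> \<alpha>" using init norm_ge_zero order_trans by blast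
    have sum_small: "C' * (\<alpha> + \<eta>) \<le> \<rho> / 2"
    proof -
      have "C' * (\<alpha> + \<eta>) \<le> C' * (\<eta>0 + \<eta>0)"
        using C' \<eta> \<alpha> by (intro mult_left_mono) auto
      also have "\<dots> = \<rho> / 2" using C' by (simp add: \<eta>0_def)
      finally show ?thesis .
    qed
    have x': "(x has_vector_derivative g (x t)) (at t within {b..c})"
      and w': "(w has_vector_derivative w' t) (at t within {b..c})" if "a \<le> b" "t \<in> {b..c}" for t b c
      using that x[of t] w[of t] by (auto elim!: has_vector_derivative_within_subset)
    have between: "norm (w t - x t) \<le> C' * (\<alpha> + \<eta>)"
      if "a \<le> b" "t \<in> {b..b+T}" "norm (w b - x b) \<le> \<alpha> + 2 * C * \<eta>" for b t
    proof -
      have "norm (w t - x t) \<le> exp ((L + 1) * (t - b)) * (norm (w b - x b) + \<eta>)"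
        by (rule deviation_growth[of b t x w w']) (use that x' w' p \<eta> in auto)
      also have "\<dots> \<le> G * ((\<alpha> + 2 * C * \<eta>) + \<eta>)"
        unfolding G_def using that L \<eta> by (intro mult_mono add_mono) (auto intro!: mult_left_mono)
      also have "\<dots> \<le> C' * (\<alpha> + \<eta>)"
        using G C \<alpha>0 by (auto simp: C'_def algebra_simps)
      finally show ?thesis .
    qed
    have grid: "norm (w (a + real n * T) - x (a + real n * T)) \<le> \<alpha> + 2 * C * \<eta>" for n
    proof (induction n)
      case 0
      show ?case using init C \<eta> by (simp add: add_increasing2)
    next
      case (Suc n)
      define b where "b = a + real n * T"
      have b: "a \<le> b" using T by (simp add: b_def)
      have dev: "norm (w t - x t) \<le> \<rho> / 2" if "t \<in> {b..b+T}" for t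
        using between[OF b that Suc[folded b_def]] sum_small by simp
      have "norm (w (b + T) - x (b + T)) \<le> norm (w b - x b) / 2 + C * \<eta>"
      proof (rule step[OF \<eta>(1) x' w' p])
        fix t assume t: "t \<in> {b..b+T}"
        have "norm (w t - xs) \<le> norm (w t - x t) + norm (x t - xs)"
          using norm_triangle_ineq[of "w t - x t" "x t - xs"] by simp
        then show "norm (x t - xs) \<le> \<rho> \<and> norm (w t - xs) \<le> \<rho>"
          using near[of t] dev[OF t] t b \<rho> by auto
      qed (use b in auto)
      also have "\<dots> \<le> (\<alpha> + 2 * C * \<eta>) / 2 + C * \<eta>"
        using Suc[folded b_def] by simp
      also have "\<dots> \<le> \<alpha> + 2 * C * \<eta>"
        using \<alpha>0 by simp
      finally show ?case by (simp add: b_def algebra_simps)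
    qed
    define n where "n = nat \<lfloor>(t - a) / T\<rfloor>"
    have n: "real n \<le> (t - a) / T" "(t - a) / T \<le> real n + 1"
      using \<open>a \<le> t\<close> T by (auto simp: n_def)
    show "norm (w t - x t) \<le> C' * (\<alpha> + \<eta>)"
      by (rule between[OF _ _ grid[of n]]) (use n T in \<open>auto simp: field_simps\<close>)
  qed
qed

text \<open>
  Each single solution reaches a small ball around \<open>xs\<close>, in which solutions are trapped. By continuous
  dependence on the initial value, neighbouring solutions do so at the same time, and finitely many of
  these neighbourhoods cover \<open>\<Omega>\<close>.
\<close>

lemma uniform_entry_time:
  assumes "compact \<Omega>" "\<Omega> \<subseteq> region_of_attraction g xs" "0 < \<rho>"
  obtains T where "0 \<le> T"
    "\<And>x0 x t. x0 \<in> \<Omega> \<Longrightarrow> ivp_solution g x0 x \<Longrightarrow> T \<le> t \<Longrightarrow> norm (x t - xs) \<le> \<rho>"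
proof -
  obtain r k c where r: "r > 0" and k: "k > 0" and c: "c > 0"
    and "\<And>x0. norm (x0 - xs) < r \<Longrightarrow> \<exists>x. ivp_solution g x0 x"
    and dec: "\<And>x0 x t. norm (x0 - xs) < r \<Longrightarrow> ivp_solution g x0 x \<Longrightarrow> 0 \<le> t \<Longrightarrow>
       norm (x t - xs) \<le> k * norm (x0 - xs) * exp (- c * t)"
    by (fact stability_constants)
  define \<sigma> where "\<sigma> = min r (\<rho> / k)"
  have \<sigma>: "0 < \<sigma>" "\<sigma> \<le> r" "k * \<sigma> \<le> \<rho>"
    using r \<open>0 < \<rho>\<close> k by (auto simp: \<sigma>_def min_def field_simps)
  have trapped: "norm (x t - xs) \<le> \<rho>" if x: "ivp_solution g x0 x" and "0 \<le> \<tau>" "\<tau> \<le> t" "norm (x \<tau> - xs) < \<sigma>" for x0 x \<tau> t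
  proof -
    have "norm (x ((t - \<tau>) + \<tau>) - xs) \<le> k * norm (x \<tau> - xs) * exp (- c * (t - \<tau>))"
      by (rule dec[OF _ ivp_solution_shift[OF x]]) (use that \<sigma> in auto)
    also have "\<dots> \<le> k * \<sigma> * 1"
      using that k c \<sigma> by (intro mult_mono) auto
    finally show ?thesis using \<sigma> by simp
  qed
  have local: "\<exists>\<tau> \<epsilon>. 0 \<le> \<tau> \<and> 0 < \<epsilon> \<and> (\<forall>y0 y. norm (y0 - x0) < \<epsilon> \<longrightarrow> ivp_solution g y0 y \<longrightarrow> norm (y \<tau> - xs) < \<sigma>)"
    if "x0 \<in> \<Omega>" for x0
  proof -
    obtain x where x: "ivp_solution g x0 x" and lim: "(x \<longlongrightarrow> xs) at_top"
      using subsetD[OF assms(2) \<open>x0 \<in> \<Omega>\<close>] unfolding region_of_attraction_def by blast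
    have "eventually (\<lambda>t. dist (x t) xs < \<sigma> / 2 \<and> 0 \<le> t) at_top"
      using \<sigma> by (intro eventually_conj tendstoD[OF lim] eventually_ge_at_top) auto
    then obtain \<tau> where \<tau>: "0 \<le> \<tau>" "norm (x \<tau> - xs) < \<sigma> / 2"
      by (auto simp: eventually_at_top_linorder dist_norm)
    define G where "G = exp ((L + 1) * \<tau>)"
    have "norm (y \<tau> - xs) < \<sigma>" if y0: "norm (y0 - x0) < \<sigma> / (2 * G)" and y: "ivp_solution g y0 y" for y0 y
    proof -
      have "norm (y \<tau> - x \<tau>) \<le> exp ((L + 1) * (\<tau> - 0)) * (norm (y 0 - x 0) + 0)"
        by (rule deviation_growth[where w' = "\<lambda>t. g (y t)"])
           (use \<tau> x y in \<open>auto intro!: ivp_solution_derivative_Icc\<close>)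
      also have "\<dots> = G * norm (y0 - x0)"
        using x y by (simp add: G_def ivp_solution_def)
      also have "\<dots> < \<sigma> / 2"
        using y0 by (simp add: G_def field_simps)
      finally show ?thesis
        using \<tau> norm_triangle_ineq[of "y \<tau> - x \<tau>" "x \<tau> - xs"] by simp
    qed
    moreover have "0 < \<sigma> / (2 * G)" using \<sigma> by (simp add: G_def)
    ultimately show ?thesis using \<tau>(1) by blast
  qed
  then obtain \<tau> \<epsilon> where \<tau>: "\<And>x0. x0 \<in> \<Omega> \<Longrightarrow> 0 \<le> \<tau> x0" and \<epsilon>: "\<And>x0. x0 \<in> \<Omega> \<Longrightarrow> 0 < \<epsilon> x0"
    and enter: "\<And>x0 y0 y. x0 \<in> \<Omega> \<Longrightarrow> norm (y0 - x0) < \<epsilon> x0 \<Longrightarrow> ivp_solution g y0 y \<Longrightarrow> norm (y (\<tau> x0) - xs) < \<sigma>"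
    by metis
  obtain X where X: "X \<subseteq> \<Omega>" "finite X" "\<Omega> \<subseteq> (\<Union>x0\<in>X. ball x0 (\<epsilon> x0))"
    by (rule compactE_image[OF \<open>compact \<Omega>\<close>, of \<Omega> "\<lambda>x0. ball x0 (\<epsilon> x0)"]) (use \<epsilon> in auto)
  \<comment> \<open>The sum bounds every single entry time and is defined also when \<open>\<Omega>\<close>, and hence \<open>X\<close>, is empty.\<close>
  show thesis
  proof (rule that[of "\<Sum>x0\<in>X. \<tau> x0"])
    show "0 \<le> (\<Sum>x0\<in>X. \<tau> x0)" using X \<tau> by (intro sum_nonneg) auto
    fix y0 y t assume y0: "y0 \<in> \<Omega>" and y: "ivp_solution g y0 y" and t: "(\<Sum>x0\<in>X. \<tau> x0) \<le> t"
    from y0 X obtain x0 where x0: "x0 \<in> X" "norm (y0 - x0) < \<epsilon> x0"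
      by (auto simp: dist_norm norm_minus_commute)
    have "\<tau> x0 \<le> (\<Sum>x0\<in>X. \<tau> x0)"
      using X \<tau> x0 by (intro member_le_sum) auto
    then show "norm (y t - xs) \<le> \<rho>"
      by (intro trapped[OF y, of "\<tau> x0"]) (use x0 X \<tau> enter y t in auto)
  qed
qed

theorem uniform_tracking:
  assumes "compact \<Omega>" "\<Omega> \<subseteq> region_of_attraction g xs"
  obtains K \<eta>0 where "0 < K" "0 < \<eta>0"
    "\<And>x0 x w w' \<eta> t. x0 \<in> \<Omega> \<Longrightarrow> ivp_solution g x0 x \<Longrightarrow> 0 \<le> \<eta> \<Longrightarrow> \<eta> \<le> \<eta>0 \<Longrightarrow> norm (w 0 - x0) \<le> \<eta> \<Longrightarrow>
      (\<And>t. 0 \<le> t \<Longrightarrow> (w has_vector_derivative w' t) (at t within {0..})) \<Longrightarrow>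
      (\<And>t. 0 \<le> t \<Longrightarrow> norm (w' t - g (w t)) \<le> \<eta>) \<Longrightarrow>
      0 \<le> t \<Longrightarrow> norm (w t - x t) \<le> K * \<eta>"
proof -
  obtain C \<rho> \<eta>1 where C: "0 < C" and \<rho>: "0 < \<rho>" and \<eta>1: "0 < \<eta>1" and local:
    "\<And>a x w w' \<eta> \<alpha> t. 0 \<le> \<eta> \<Longrightarrow> \<eta> \<le> \<eta>1 \<Longrightarrow> \<alpha> \<le> \<eta>1 \<Longrightarrow> norm (w a - x a) \<le> \<alpha> \<Longrightarrow>
      (\<And>t. a \<le> t \<Longrightarrow> (x has_vector_derivative g (x t)) (at t within {a..})) \<Longrightarrow>
      (\<And>t. a \<le> t \<Longrightarrow> (w has_vector_derivative w' t) (at t within {a..})) \<Longrightarrow>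
      (\<And>t. a \<le> t \<Longrightarrow> norm (w' t - g (w t)) \<le> \<eta>) \<Longrightarrow>
      (\<And>t. a \<le> t \<Longrightarrow> norm (x t - xs) \<le> \<rho>) \<Longrightarrow>
      a \<le> t \<Longrightarrow> norm (w t - x t) \<le> C * (\<alpha> + \<eta>)"
    by (fact local_tracking)
  obtain T where T: "0 \<le> T" and entry:
    "\<And>x0 x t. x0 \<in> \<Omega> \<Longrightarrow> ivp_solution g x0 x \<Longrightarrow> T \<le> t \<Longrightarrow> norm (x t - xs) \<le> \<rho>"
    by (fact uniform_entry_time[OF assms \<rho>])
  define G where "G = 2 * exp ((L + 1) * T)"
  have G: "1 \<le> G"
    using T L one_le_exp_iff[of "(L + 1) * T"] by (simp add: G_def del: one_le_exp_iff)
  show thesis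
  proof (rule that[of "G + C * (G + 1)" "\<eta>1 / G"])
    have "0 < G" using G by simp
    then show "0 < G + C * (G + 1)" "0 < \<eta>1 / G" using C \<eta>1 by (auto intro!: add_pos_pos mult_pos_pos)
    fix x0 x w w' \<eta> and t :: real
    assume x0: "x0 \<in> \<Omega>" and x: "ivp_solution g x0 x" and \<eta>: "0 \<le> \<eta>" "\<eta> \<le> \<eta>1 / G" and init: "norm (w 0 - x0) \<le> \<eta>"
      and w: "\<And>t. 0 \<le> t \<Longrightarrow> (w has_vector_derivative w' t) (at t within {0..})"
      and p: "\<And>t. 0 \<le> t \<Longrightarrow> norm (w' t - g (w t)) \<le> \<eta>" and t: "0 \<le> t"
    have G\<eta>: "G * \<eta> \<le> \<eta>1" using \<eta> G by (simp add: field_simps)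
    have \<eta>_le: "\<eta> \<le> G * \<eta>" using \<eta> G by (simp add: mult_le_cancel_right1)
    have early: "norm (w t - x t) \<le> G * \<eta>" if "0 \<le> t" "t \<le> T" for t
    proof -
      have "norm (w t - x t) \<le> exp ((L + 1) * (t - 0)) * (norm (w 0 - x 0) + \<eta>)"
      proof (rule deviation_growth[OF _ _ p \<eta>(1)])
        show "(x has_vector_derivative g (x s)) (at s within {0..t})" if "s \<in> {0..t}" for s
          using ivp_solution_derivative_Icc[OF x _ that] by simp
        show "(w has_vector_derivative w' s) (at s within {0..t})" if "s \<in> {0..t}" for s
          using w[of s] that by (auto elim!: has_vector_derivative_within_subset)
      qed (use that in auto)
      also have "\<dots> \<le> exp ((L + 1) * T) * (\<eta> + \<eta>)"
        using init x that L \<eta> by (intro mult_mono) (auto simp: ivp_solution_def intro!: mult_left_mono)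
      finally show ?thesis by (simp add: G_def)
    qed
    have late: "norm (w t - x t) \<le> C * (G * \<eta> + \<eta>)" if "T \<le> t" for t
    proof (rule local[of \<eta> "G * \<eta>" w T x w'])
      show "(x has_vector_derivative g (x s)) (at s within {T..})" if "T \<le> s" for s
      proof (rule has_vector_derivative_within_subset)
        show "(x has_vector_derivative g (x s)) (at s within {0..})"
          using x that T by (simp add: ivp_solution_def)
      qed (use T in auto)
      show "(w has_vector_derivative w' s) (at s within {T..})" if "T \<le> s" for s
        using w[of s] that T by (auto elim!: has_vector_derivative_within_subset)
    qed (use \<eta> G\<eta> \<eta>_le early[OF T] p T entry[OF x0 x] that in auto)
    show "norm (w t - x t) \<le> (G + C * (G + 1)) * \<eta>"
    proof (cases "t \<le> T")
      case True
      have "0 \<le> C * (G + 1) * \<eta>" using C G \<eta> by simp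
      then show ?thesis using early[OF t True] by (simp add: algebra_simps)
    next
      case False
      have "0 \<le> G * \<eta>" using G \<eta> by simp
      then show ?thesis using late[of t] False by (simp add: algebra_simps)
    qed
  qed
qed

end

lemma (in stable_ode) region_of_attraction_exponential:
  assumes "x0 \<in> region_of_attraction g xs" "ivp_solution g x0 x"
  shows "converges_exponentially_to_zero (\<lambda>t. x t - xs)"
proof -
  obtain r k c where r: "r > 0" and k: "k > 0" and c: "c > 0"
    and "\<And>x0. norm (x0 - xs) < r \<Longrightarrow> \<exists>x. ivp_solution g x0 x"
    and dec: "\<And>x0 x t. norm (x0 - xs) < r \<Longrightarrow> ivp_solution g x0 x \<Longrightarrow> 0 \<le> t \<Longrightarrow>
       norm (x t - xs) \<le> k * norm (x0 - xs) * exp (- c * t)"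
    by (fact stability_constants)
  have "(x \<longlongrightarrow> xs) at_top"
    using assms unfolding region_of_attraction_def by blast
  then have "eventually (\<lambda>t. dist (x t) xs < r \<and> 0 \<le> t) at_top"
    using r by (intro eventually_conj tendstoD eventually_ge_at_top) auto
  then obtain a where a: "0 \<le> a" "norm (x a - xs) < r"
    by (auto simp: eventually_at_top_linorder dist_norm)
  show ?thesis
  proof (rule converges_exponentially_from[OF _ c a(1)])
    show "continuous_on {0..} (\<lambda>t. x t - xs)"
      using assms(2) by (intro continuous_intros continuous_on_vector_derivative) (auto simp: ivp_solution_def)
    show "norm (x t - xs) \<le> k * norm (x a - xs) * exp (- c * (t - a))" if "a \<le> t" for t
      using dec[OF a(2) ivp_solution_shift[OF assms(2) a(1)], of "t - a"] that by simp
  qed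
qed

section \<open>Slow-fast systems with linear relaxation\<close>

text \<open>
  The equation \<open>x' = B v\<close>, \<open>\<epsilon> v\<^sub>i' = F\<^sub>i (h\<^sub>i(x) - v\<^sub>i)\<close>. The bounds on \<open>h\<close> and its derivative are
  global, as is natural for trigonometric couplings; therefore solutions exist for all
  times, and from bounded initial values \<open>v\<close> stays bounded uniformly in time and in \<open>\<epsilon>\<close>.
\<close>

locale slow_fast =
  fixes B :: "real ^ 'n::finite \<Rightarrow> 'x::euclidean_space" and F :: "'n \<Rightarrow> real"
    and h :: "'x \<Rightarrow> real ^ 'n" and h' :: "'x \<Rightarrow> 'x \<Rightarrow> real ^ 'n" and H Lh L2 :: real
  assumes B: "bounded_linear B" and F: "0 < F i"
    and h_bound: "norm (h x) \<le> H"
    and h_der: "(h has_derivative h' x) (at x)"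
    and h'_bound: "norm (h' x \<xi>) \<le> Lh * norm \<xi>" and Lh: "0 \<le> Lh"
    and h'_lip: "norm (h' x \<xi> - h' y \<xi>) \<le> L2 * norm (x - y) * norm \<xi>" and L2: "0 \<le> L2"
begin

definition reduced :: "'x \<Rightarrow> 'x" where
  "reduced x = B (h x)"

definition field :: "real \<Rightarrow> 'x \<times> (real ^ 'n) \<Rightarrow> 'x \<times> (real ^ 'n)" where
  "field \<epsilon> = (\<lambda>(x, v). (B v, \<chi> i. F i / \<epsilon> * (h x $ i - v $ i)))"

definition solution :: "real \<Rightarrow> 'x \<Rightarrow> real ^ 'n \<Rightarrow> (real \<Rightarrow> 'x) \<Rightarrow> (real \<Rightarrow> real ^ 'n) \<Rightarrow> bool" where
  "solution \<epsilon> x0 v0 x v \<longleftrightarrow> ivp_solution (field \<epsilon>) (x0, v0) (\<lambda>t. (x t, v t))"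

abbreviation KB :: real where "KB \<equiv> onorm B"

lemma B_bound: "norm (B v) \<le> KB * norm v"
  by (rule onorm[OF B])

lemma KB: "0 \<le> KB"
  by (rule onorm_pos_le[OF B])

lemma h_lip: "norm (h x - h y) \<le> Lh * norm (x - y)"
proof (rule differentiable_bound[where S = UNIV and f' = h'])
  show "onorm (h' z) \<le> Lh" for z
    by (rule onorm_bound) (use Lh h'_bound in auto)
qed (use h_der in auto)

lemma reduced_lip: "norm (reduced x - reduced y) \<le> KB * Lh * norm (x - y)"
proof -
  have "norm (reduced x - reduced y) \<le> KB * norm (h x - h y)"
    using B_bound[of "h x - h y"] by (simp add: reduced_def linear_diff[OF bounded_linear.linear[OF B]])
  also have "\<dots> \<le> KB * (Lh * norm (x - y))"
    by (intro mult_left_mono h_lip KB)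
  finally show ?thesis by simp
qed

lemma reduced_strict: "strictly_differentiable reduced (\<lambda>\<xi>. B (h' z \<xi>)) z"
  unfolding strictly_differentiable_def
proof (intro conjI allI impI)
  have blin: "bounded_linear (h' x)" for x by (rule has_derivative_bounded_linear[OF h_der])
  show "bounded_linear (\<lambda>\<xi>. B (h' z \<xi>))"
    by (rule bounded_linear_compose[OF B blin])
  fix e :: real assume "0 < e"
  define \<rho> where "\<rho> = e / (KB * L2 + 1)"
  have pos: "0 < KB * L2 + 1" using KB L2 by (simp add: add_nonneg_pos)
  have \<rho>: "0 < \<rho>" "KB * (L2 * \<rho>) \<le> e"
    using \<open>0 < e\<close> pos by (auto simp: \<rho>_def field_simps)
  have "norm (reduced x - reduced y - B (h' z (x - y))) \<le> e * norm (x - y)"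
    if "x \<in> cball z \<rho>" "y \<in> cball z \<rho>" for x y
  proof -
    have "norm ((h x - h' z x) - (h y - h' z y)) \<le> (L2 * \<rho>) * norm (x - y)"
    proof (rule differentiable_bound[where S = "cball z \<rho>" and f' = "\<lambda>u \<xi>. h' u \<xi> - h' z \<xi>"])
      fix u assume u: "u \<in> cball z \<rho>"
      show "((\<lambda>x. h x - h' z x) has_derivative (\<lambda>\<xi>. h' u \<xi> - h' z \<xi>)) (at u within cball z \<rho>)"
        by (intro has_derivative_diff has_derivative_at_withinI[OF h_der] bounded_linear_imp_has_derivative blin)
      show "onorm (\<lambda>\<xi>. h' u \<xi> - h' z \<xi>) \<le> L2 * \<rho>"
      proof (rule onorm_bound)
        fix \<xi>
        have "norm (h' u \<xi> - h' z \<xi>) \<le> L2 * norm (u - z) * norm \<xi>" by (rule h'_lip)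
        also have "\<dots> \<le> L2 * \<rho> * norm \<xi>"
          using u L2 by (intro mult_right_mono mult_left_mono) (auto simp: dist_norm norm_minus_commute)
        finally show "norm (h' u \<xi> - h' z \<xi>) \<le> L2 * \<rho> * norm \<xi>" .
      qed (use L2 \<rho> in auto)
    qed (use that in auto)
    moreover have "reduced x - reduced y - B (h' z (x - y)) = B ((h x - h' z x) - (h y - h' z y))"
      by (simp add: reduced_def linear_diff[OF bounded_linear.linear[OF B]] linear_diff[OF bounded_linear.linear[OF blin]])
    ultimately have "norm (reduced x - reduced y - B (h' z (x - y))) \<le> KB * (L2 * \<rho> * norm (x - y))"
      by (metis B_bound KB mult_left_mono order_trans)
    also have "\<dots> \<le> e * norm (x - y)"
      using mult_right_mono[OF \<rho>(2), of "norm (x - y)"] by (simp add: mult_ac)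
    finally show ?thesis .
  qed
  then show "\<exists>\<rho>>0. \<forall>x\<in>cball z \<rho>. \<forall>y\<in>cball z \<rho>. norm (reduced x - reduced y - B (h' z (x - y))) \<le> e * norm (x - y)"
    using \<rho>(1) by blast
qed

lemma field_lip:
  assumes "0 < \<epsilon>"
  shows "norm (field \<epsilon> p - field \<epsilon> q) \<le> (KB + (\<Sum>i\<in>UNIV. F i / \<epsilon>) * (Lh + 1)) * norm (p - q)"
proof -
  obtain x v y w where [simp]: "p = (x, v)" "q = (y, w)" by fastforce
  have xy: "norm (x - y) \<le> norm (p - q)" and vw: "norm (v - w) \<le> norm (p - q)"
    using norm_fst_le[of "x - y" "v - w"] norm_snd_le[of "v - w" "x - y"] by auto
  have 1: "norm (B v - B w) \<le> KB * norm (p - q)"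
    using order_trans[OF B_bound[of "v - w"] mult_left_mono[OF vw KB]]
    by (simp add: linear_diff[OF bounded_linear.linear[OF B]])
  have "norm ((\<chi> i. F i / \<epsilon> * (h x $ i - v $ i)) - (\<chi> i. F i / \<epsilon> * (h y $ i - w $ i)))
      \<le> (\<Sum>i\<in>UNIV. \<bar>F i / \<epsilon> * ((h x - h y) $ i - (v - w) $ i)\<bar>)"
    by (rule order_trans[OF norm_le_l1_cart]) (simp add: algebra_simps)
  also have "\<dots> \<le> (\<Sum>i\<in>UNIV. F i / \<epsilon> * ((Lh + 1) * norm (p - q)))"
  proof (rule sum_mono)
    fix i
    have "\<bar>(h x - h y) $ i - (v - w) $ i\<bar> \<le> norm (h x - h y) + norm (v - w)"
      using component_le_norm_cart[of "h x - h y" i] component_le_norm_cart[of "v - w" i] by linarith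
    also have "\<dots> \<le> Lh * norm (p - q) + norm (p - q)"
      using order_trans[OF h_lip mult_left_mono[OF xy Lh]] vw by (intro add_mono)
    finally show "\<bar>F i / \<epsilon> * ((h x - h y) $ i - (v - w) $ i)\<bar> \<le> F i / \<epsilon> * ((Lh + 1) * norm (p - q))"
      using F[of i] assms unfolding abs_mult by (intro mult_mono) (auto simp: algebra_simps)
  qed
  finally have 2: "norm ((\<chi> i. F i / \<epsilon> * (h x $ i - v $ i)) - (\<chi> i. F i / \<epsilon> * (h y $ i - w $ i)))
      \<le> (\<Sum>i\<in>UNIV. F i / \<epsilon>) * (Lh + 1) * norm (p - q)"
    by (simp only: sum_distrib_right mult.assoc)
  show ?thesis
    using norm_Pair_le[of "B v - B w" "(\<chi> i. F i / \<epsilon> * (h x $ i - v $ i)) - (\<chi> i. F i / \<epsilon> * (h y $ i - w $ i))"] 1 2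
    by (simp add: field_def algebra_simps)
qed

lemma field_lip_nonneg: "0 < \<epsilon> \<Longrightarrow> 0 \<le> KB + (\<Sum>i\<in>UNIV. F i / \<epsilon>) * (Lh + 1)"
  using KB F Lh by (intro add_nonneg_nonneg mult_nonneg_nonneg sum_nonneg) (auto simp: less_imp_le)

lemma solution_exists: "0 < \<epsilon> \<Longrightarrow> \<exists>x v. solution \<epsilon> x0 v0 x v"
proof -
  assume "0 < \<epsilon>"
  then obtain z where "ivp_solution (field \<epsilon>) (x0, v0) z"
    using lipschitz_ivp_exists[OF field_lip field_lip_nonneg] by blast
  then have "solution \<epsilon> x0 v0 (\<lambda>t. fst (z t)) (\<lambda>t. snd (z t))"
    by (simp add: solution_def)
  then show ?thesis by blast
qed

lemma solution_unique:
  assumes "0 < \<epsilon>" "solution \<epsilon> x0 v0 x v" "solution \<epsilon> x0 v0 y w" "0 \<le> t"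
  shows "x t = y t" "v t = w t"
  using lipschitz_ivp_unique[OF field_lip[OF assms(1)] field_lip_nonneg[OF assms(1)]
      assms(2,3)[unfolded solution_def] assms(4)] by auto

lemma solution_derivatives:
  assumes "solution \<epsilon> x0 v0 x v" "0 \<le> t"
  shows "(x has_vector_derivative B (v t)) (at t within {0..})"
    and "(v has_vector_derivative (\<chi> i. F i / \<epsilon> * (h (x t) $ i - v t $ i))) (at t within {0..})"
proof -
  have *: "((\<lambda>t. (x t, v t)) has_vector_derivative field \<epsilon> (x t, v t)) (at t within {0..})"
    using assms by (simp add: solution_def ivp_solution_def)
  from bounded_linear.has_vector_derivative[OF bounded_linear_fst *]
  show "(x has_vector_derivative B (v t)) (at t within {0..})" by (simp add: field_def)
  from bounded_linear.has_vector_derivative[OF bounded_linear_snd *]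
  show "(v has_vector_derivative (\<chi> i. F i / \<epsilon> * (h (x t) $ i - v t $ i))) (at t within {0..})"
    by (simp add: field_def)
qed

lemma solution_continuous:
  assumes "solution \<epsilon> x0 v0 x v"
  shows "continuous_on {0..} x" "continuous_on {0..} v"
  by (rule continuous_on_vector_derivative, rule solution_derivatives[OF assms], simp)+

lemma solution_initial:
  assumes "solution \<epsilon> x0 v0 x v"
  shows "x 0 = x0" "v 0 = v0"
  using assms by (auto simp: solution_def ivp_solution_def)

lemma solution_component_derivative:
  assumes "solution \<epsilon> x0 v0 x v" "0 \<le> a" "t \<in> {a..b}"
  shows "((\<lambda>t. v t $ i) has_real_derivative F i / \<epsilon> * (h (x t) $ i - v t $ i)) (at t within {a..b})"
proof -
  have "((\<lambda>t. v t $ i) has_real_derivative F i / \<epsilon> * (h (x t) $ i - v t $ i)) (at t within {0..})"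
    using solution_derivatives(2)[OF assms(1), of t] assms by (simp add: has_vector_derivative_vec_iff)
  then show ?thesis by (rule DERIV_subset) (use assms in auto)
qed

lemma solution_v_bound:
  assumes sol: "solution \<epsilon> x0 v0 x v" and "0 < \<epsilon>" "norm v0 \<le> V" "0 \<le> t"
  shows "norm (v t) \<le> real CARD('n) * (V + H)"
proof (rule norm_vec_le_card)
  fix i
  have "\<bar>v t $ i\<bar> \<le> exp (- (F i / \<epsilon>) * (t - 0)) * \<bar>v 0 $ i\<bar> + H"
    by (rule relaxation_bound[OF solution_component_derivative[OF sol order_refl]])
       (use F[of i] \<open>0 < \<epsilon>\<close> \<open>0 \<le> t\<close> order_trans[OF component_le_norm_cart h_bound] in auto)
  also have "exp (- (F i / \<epsilon>) * (t - 0)) * \<bar>v 0 $ i\<bar> \<le> 1 * V"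
  proof (rule mult_mono)
    show "exp (- (F i / \<epsilon>) * (t - 0)) \<le> 1"
      using F[of i] \<open>0 < \<epsilon>\<close> \<open>0 \<le> t\<close> by simp
    show "\<bar>v 0 $ i\<bar> \<le> V"
      using component_le_norm_cart[of "v 0" i] assms(3) solution_initial[OF sol] by simp
  qed auto
  finally show "\<bar>v t $ i\<bar> \<le> V + H" by simp
qed

text \<open>
  The slow displacement that a deviation of the fast variable still causes while it relaxes, per unit
  of \<open>\<epsilon>\<close>: it is the integral of \<open>B v\<close> over the solution of \<open>v\<^sub>i' = - F\<^sub>i v\<^sub>i\<close> on the half-line.
\<close>

definition lag :: "real ^ 'n \<Rightarrow> 'x" where
  "lag v = B (\<chi> i. v $ i / F i)"

lemma lag_bounded_linear: "bounded_linear lag"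
proof -
  have "linear (\<lambda>v :: real ^ 'n. \<chi> i. v $ i / F i)"
    by (rule linearI) (simp_all add: vec_eq_iff add_divide_distrib)
  then have "bounded_linear (\<lambda>v :: real ^ 'n. \<chi> i. v $ i / F i)"
    by (rule linear_conv_bounded_linear[THEN iffD1])
  from bounded_linear_compose[OF B this] show ?thesis
    unfolding lag_def .
qed

abbreviation Klag :: real where "Klag \<equiv> onorm lag"

lemma lag_bound: "norm (lag v) \<le> Klag * norm v"
  by (rule onorm[OF lag_bounded_linear])

lemma Klag: "0 \<le> Klag"
  by (rule onorm_pos_le[OF lag_bounded_linear])

text \<open>
  Differentiating the correction term produces \<open>B (h(x) - v)\<close>, which replaces \<open>B v\<close> by \<open>B (h(x))\<close>
  without any remainder. The constant \<open>c\<close> is \<open>0\<close> for the uniform estimate, and \<open>h(xs)\<close> when the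
  corrected variable should have \<open>xs\<close> as its equilibrium value.
\<close>

lemma corrected_derivative:
  assumes sol: "solution \<epsilon> x0 v0 x v" and "0 < \<epsilon>" "0 \<le> t"
  shows "((\<lambda>t. x t + \<epsilon> *\<^sub>R lag (v t - c)) has_vector_derivative reduced (x t)) (at t within {0..})"
proof -
  have "((\<lambda>t. v t - c) has_vector_derivative (\<chi> i. F i / \<epsilon> * (h (x t) $ i - v t $ i))) (at t within {0..})"
    using solution_derivatives(2)[OF sol \<open>0 \<le> t\<close>] by (auto intro!: derivative_eq_intros)
  from bounded_linear.has_vector_derivative[OF lag_bounded_linear this]
  have "((\<lambda>t. x t + \<epsilon> *\<^sub>R lag (v t - c)) has_vector_derivative
      B (v t) + \<epsilon> *\<^sub>R lag (\<chi> i. F i / \<epsilon> * (h (x t) $ i - v t $ i))) (at t within {0..})"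
    using solution_derivatives(1)[OF sol \<open>0 \<le> t\<close>] by (auto intro!: derivative_eq_intros)
  moreover have "\<epsilon> *\<^sub>R lag (\<chi> i. F i / \<epsilon> * (h (x t) $ i - v t $ i)) = B (h (x t) - v t)"
  proof -
    have "(\<chi> i. (\<chi> i. F i / \<epsilon> * (h (x t) $ i - v t $ i)) $ i / F i) = (1 / \<epsilon>) *\<^sub>R (h (x t) - v t)"
      using F by (simp add: vec_eq_iff less_imp_neq[symmetric])
    then show ?thesis
      using \<open>0 < \<epsilon>\<close> by (simp add: lag_def linear_cmul[OF bounded_linear.linear[OF B]])
  qed
  ultimately show ?thesis
    by (simp add: reduced_def linear_diff[OF bounded_linear.linear[OF B]])
qed

end

section \<open>Approximation by the reduced equation\<close>

locale stable_slow_fast = slow_fast B F h h' H Lh L2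
  for B :: "real ^ 'n::finite \<Rightarrow> 'x::euclidean_space" and F h h' H Lh L2 +
  fixes xs :: 'x
  assumes reduced_stable: "exponentially_stable_fixed_point reduced xs"
begin

sublocale stable_ode reduced "KB * Lh" xs "\<lambda>\<xi>. B (h' xs \<xi>)"
  by unfold_locales (use KB Lh reduced_lip reduced_strict reduced_stable in auto)

definition layer :: "'x \<Rightarrow> real ^ 'n \<Rightarrow> real \<Rightarrow> real ^ 'n" where
  "layer x0 v0 \<tau> = (\<chi> i. (v0 $ i - h x0 $ i) * exp (- F i * \<tau>))"

text \<open>
  The layer is exponentially small in \<open>1/\<epsilon>\<close> from the time \<open>b\<close> on; \<open>exp(-z) \<le> 1/z\<close> suffices here.
\<close>

lemma layer_after_positive_time:
  assumes "norm (v0 - h x0) \<le> c" "0 < \<epsilon>" "0 < b" "b \<le> t"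
  shows "norm (layer x0 v0 (t / \<epsilon>)) \<le> (\<Sum>i\<in>UNIV. c / (F i * b)) * \<epsilon>"
proof -
  have "norm (layer x0 v0 (t / \<epsilon>)) \<le> (\<Sum>i\<in>UNIV. \<bar>layer x0 v0 (t / \<epsilon>) $ i\<bar>)"
    by (rule norm_le_l1_cart)
  also have "\<dots> \<le> (\<Sum>i\<in>UNIV. c / (F i * b) * \<epsilon>)"
  proof (rule sum_mono)
    fix i
    have z: "0 < F i * b / \<epsilon>" using F[of i] assms by simp
    have "exp (- F i * (t / \<epsilon>)) \<le> exp (- (F i * b / \<epsilon>))"
      using F[of i] assms by (simp add: divide_right_mono)
    also have "\<dots> \<le> inverse (F i * b / \<epsilon>)"
      unfolding exp_minus using z exp_ge_add_one_self[of "F i * b / \<epsilon>"]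
      by (intro le_imp_inverse_le) linarith+
    finally have "exp (- F i * (t / \<epsilon>)) \<le> \<epsilon> / (F i * b)" by simp
    moreover have "\<bar>v0 $ i - h x0 $ i\<bar> \<le> c"
      using component_le_norm_cart[of "v0 - h x0" i] assms(1) by simp
    ultimately have "\<bar>v0 $ i - h x0 $ i\<bar> * exp (- F i * (t / \<epsilon>)) \<le> c * (\<epsilon> / (F i * b))"
      by (intro mult_mono) auto
    then show "\<bar>layer x0 v0 (t / \<epsilon>) $ i\<bar> \<le> c / (F i * b) * \<epsilon>"
      by (simp add: layer_def abs_mult)
  qed
  finally show ?thesis by (simp only: sum_distrib_right)
qed

lemma layer_exponential:
  assumes "0 < \<epsilon>"
  shows "converges_exponentially_to_zero (\<lambda>t. layer x0 v0 (t / \<epsilon>))"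
  unfolding converges_exponentially_to_zero_def
proof (intro exI conjI allI impI)
  show pos: "0 < Min (range F) / \<epsilon>" using F assms by simp
  fix t :: real assume t: "0 \<le> t"
  have "norm (layer x0 v0 (t / \<epsilon>)) \<le> (\<Sum>i\<in>UNIV. \<bar>layer x0 v0 (t / \<epsilon>) $ i\<bar>)"
    by (rule norm_le_l1_cart)
  also have "\<dots> \<le> (\<Sum>i\<in>UNIV. \<bar>v0 $ i - h x0 $ i\<bar> * exp (- (Min (range F) / \<epsilon>) * t))"
  proof (rule sum_mono)
    fix i
    have "Min (range F) * (t / \<epsilon>) \<le> F i * (t / \<epsilon>)"
      using t assms by (intro mult_right_mono Min_le) auto
    then show "\<bar>layer x0 v0 (t / \<epsilon>) $ i\<bar> \<le> \<bar>v0 $ i - h x0 $ i\<bar> * exp (- (Min (range F) / \<epsilon>) * t)"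
      by (auto simp: layer_def abs_mult intro!: mult_left_mono)
  qed
  finally show "norm (layer x0 v0 (t / \<epsilon>)) \<le> (\<Sum>i\<in>UNIV. \<bar>v0 $ i - h x0 $ i\<bar>) * exp (- (Min (range F) / \<epsilon>) * t)"
    by (simp only: sum_distrib_right)
qed

text \<open>
  The corrected variable \<open>w = x + \<epsilon> lag v\<close> fits the hypotheses of \<open>uniform_tracking\<close>: the rate of
  change \<open>reduced (x t)\<close> differs from \<open>reduced (w t)\<close> by at most the Lipschitz constant times
  \<open>norm (w t - x t)\<close>, which is of order \<open>\<epsilon>\<close> since \<open>v\<close> is bounded.
\<close>

theorem slow_approximation:
  assumes "compact \<Omega>" "\<Omega> \<subseteq> region_of_attraction reduced xs" "0 \<le> V"
  obtains K \<epsilon>1 where "0 < K" "0 < \<epsilon>1"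
    "\<And>\<epsilon> x0 v0 x v xbar t. 0 < \<epsilon> \<Longrightarrow> \<epsilon> < \<epsilon>1 \<Longrightarrow> x0 \<in> \<Omega> \<Longrightarrow> norm v0 \<le> V \<Longrightarrow> solution \<epsilon> x0 v0 x v \<Longrightarrow>
       ivp_solution reduced x0 xbar \<Longrightarrow> 0 \<le> t \<Longrightarrow> norm (x t - xbar t) \<le> K * \<epsilon>"
proof -
  obtain K \<eta>0 where K: "0 < K" and \<eta>0: "0 < \<eta>0" and track:
    "\<And>x0 x w w' \<eta> t. x0 \<in> \<Omega> \<Longrightarrow> ivp_solution reduced x0 x \<Longrightarrow> 0 \<le> \<eta> \<Longrightarrow> \<eta> \<le> \<eta>0 \<Longrightarrow> norm (w 0 - x0) \<le> \<eta> \<Longrightarrow>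
      (\<And>t. 0 \<le> t \<Longrightarrow> (w has_vector_derivative w' t) (at t within {0..})) \<Longrightarrow>
      (\<And>t. 0 \<le> t \<Longrightarrow> norm (w' t - reduced (w t)) \<le> \<eta>) \<Longrightarrow>
      0 \<le> t \<Longrightarrow> norm (w t - x t) \<le> K * \<eta>"
    by (fact uniform_tracking[OF assms(1,2)])
  have H: "0 \<le> H" using order_trans[OF norm_ge_zero h_bound] .
  define VB where "VB = real CARD('n) * (V + H)"
  define c where "c = Klag * VB + 1"
  have VB: "0 \<le> VB" using H assms(3) by (simp add: VB_def)
  have c: "0 < c" using Klag VB by (simp add: c_def add_nonneg_pos)
  define L where "L = KB * Lh + 1"
  have L: "1 \<le> L" "KB * Lh \<le> L" using KB Lh by (auto simp: L_def)
  show thesis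
  proof (rule that[of "K * (L * c) + c" "\<eta>0 / (L * c)"])
    show "0 < K * (L * c) + c" "0 < \<eta>0 / (L * c)" using K c L \<eta>0 by (auto intro!: add_pos_pos mult_pos_pos divide_pos_pos)
    fix \<epsilon> x0 v0 x v xbar and t :: real
    assume \<epsilon>: "0 < \<epsilon>" "\<epsilon> < \<eta>0 / (L * c)" and x0: "x0 \<in> \<Omega>" and v0: "norm v0 \<le> V"
      and sol: "solution \<epsilon> x0 v0 x v" and xbar: "ivp_solution reduced x0 xbar" and t: "0 \<le> t"
    define w where "w = (\<lambda>t. x t + \<epsilon> *\<^sub>R lag (v t))"
    have wx: "norm (w t - x t) \<le> c * \<epsilon>" if "0 \<le> t" for t
    proof -
      have "norm (lag (v t)) \<le> Klag * VB"
        using order_trans[OF lag_bound mult_left_mono[OF solution_v_bound[OF sol \<epsilon>(1) v0 that] Klag]] by (simp add: VB_def)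
      also have "\<dots> \<le> c" by (simp add: c_def)
      finally show ?thesis using \<epsilon> by (simp add: w_def mult.commute mult_left_mono)
    qed
    have le: "c * \<epsilon> \<le> L * c * \<epsilon>"
      using L c \<epsilon> by (auto intro!: mult_right_mono simp: mult_le_cancel_right1)
    have "norm (w t - xbar t) \<le> K * (L * c * \<epsilon>)"
    proof (rule track[OF x0 xbar, of "L * c * \<epsilon>" w "\<lambda>t. reduced (x t)"])
      show "0 \<le> L * c * \<epsilon>" using L c \<epsilon> by simp
      show "L * c * \<epsilon> \<le> \<eta>0" using L c \<epsilon> by (simp add: field_simps)
      show "norm (w 0 - x0) \<le> L * c * \<epsilon>"
        using wx[of 0] solution_initial[OF sol] le by simp
      show "(w has_vector_derivative reduced (x t)) (at t within {0..})" if "0 \<le> t" for t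
        using corrected_derivative[OF sol \<epsilon>(1) that, of 0] by (simp add: w_def)
      show "norm (reduced (x t) - reduced (w t)) \<le> L * c * \<epsilon>" if "0 \<le> t" for t
      proof -
        have "norm (reduced (x t) - reduced (w t)) \<le> KB * Lh * norm (w t - x t)"
          using reduced_lip[of "x t" "w t"] by (simp add: norm_minus_commute)
        also have "\<dots> \<le> L * (c * \<epsilon>)"
          using wx[OF that] L KB Lh by (intro mult_mono) auto
        finally show ?thesis by simp
      qed
    qed (rule t)
    moreover have "norm (x t - xbar t) \<le> norm (w t - xbar t) + norm (w t - x t)"
      using norm_triangle_ineq4[of "w t - xbar t" "w t - x t"] by simp
    ultimately show "norm (x t - xbar t) \<le> (K * (L * c) + c) * \<epsilon>"
      using wx[OF t] by (simp add: algebra_simps)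
  qed
qed

text \<open>
  The error \<open>e\<close> starts at \<open>0\<close>, since the layer carries the whole initial deviation. In each component
  it relaxes with the rate \<open>F i / \<epsilon>\<close> towards \<open>h(x) - h(xbar)\<close> minus \<open>\<epsilon> / F i\<close> times the derivative of
  \<open>h(xbar)\<close>, and both are of order \<open>\<epsilon>\<close>.
\<close>

lemma fast_approximation:
  assumes sol: "solution \<epsilon> x0 v0 x v" and "0 < \<epsilon>" and xbar: "ivp_solution reduced x0 xbar"
    and slow: "\<And>t. 0 \<le> t \<Longrightarrow> norm (x t - xbar t) \<le> K * \<epsilon>" and "0 \<le> t"
  shows "norm (v t - h (xbar t) - layer x0 v0 (t / \<epsilon>)) \<le> (\<Sum>i\<in>UNIV. Lh * K + Lh * (KB * H) / F i) * \<epsilon>"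
proof -
  have "norm (v t - h (xbar t) - layer x0 v0 (t / \<epsilon>)) \<le> (\<Sum>i\<in>UNIV. \<bar>(v t - h (xbar t) - layer x0 v0 (t / \<epsilon>)) $ i\<bar>)"
    by (rule norm_le_l1_cart)
  also have "\<dots> \<le> (\<Sum>i\<in>UNIV. (Lh * K + Lh * (KB * H) / F i) * \<epsilon>)"
  proof (rule sum_mono)
    fix i
    define e where "e = (\<lambda>s. (v s - h (xbar s) - layer x0 v0 (s / \<epsilon>)) $ i)"
    define D where "D = (\<lambda>s. h' (xbar s) (reduced (xbar s)) $ i)"
    have Fi: "0 < F i" by (rule F)
    have "\<bar>e t\<bar> \<le> exp (- (F i / \<epsilon>) * (t - 0)) * \<bar>e 0\<bar> + (Lh * K + Lh * (KB * H) / F i) * \<epsilon>"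
    proof (rule relaxation_bound[where q = "\<lambda>s. (h (x s) - h (xbar s)) $ i - \<epsilon> / F i * D s"])
      fix s assume s: "s \<in> {0..t}"
      have "(xbar has_vector_derivative reduced (xbar s)) (at s within {0..t})"
        using ivp_solution_derivative_Icc[OF xbar order_refl s] .
      from vector_derivative_diff_chain_within[OF this has_derivative_at_withinI[OF h_der]]
      have "(h \<circ> xbar has_vector_derivative h' (xbar s) (reduced (xbar s))) (at s within {0..t})" .
      then have hd: "((\<lambda>s. h (xbar s) $ i) has_real_derivative D s) (at s within {0..t})"
        by (simp add: has_vector_derivative_vec_iff D_def o_def)
      have ld: "((\<lambda>s. layer x0 v0 (s / \<epsilon>) $ i) has_real_derivative
          - (F i / \<epsilon>) * (layer x0 v0 (s / \<epsilon>) $ i)) (at s within {0..t})"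
        unfolding layer_def using \<open>0 < \<epsilon>\<close> by (auto intro!: derivative_eq_intros)
      have "(e has_real_derivative F i / \<epsilon> * (h (x s) $ i - v s $ i) - D s - (- (F i / \<epsilon>) * (layer x0 v0 (s / \<epsilon>) $ i)))
          (at s within {0..t})"
        unfolding e_def vector_minus_component
        by (intro DERIV_diff hd ld solution_component_derivative[OF sol order_refl s])
      moreover have "F i / \<epsilon> * (h (x s) $ i - v s $ i) - D s - (- (F i / \<epsilon>) * (layer x0 v0 (s / \<epsilon>) $ i))
          = F i / \<epsilon> * ((h (x s) - h (xbar s)) $ i - \<epsilon> / F i * D s - e s)"
        using Fi \<open>0 < \<epsilon>\<close> by (simp add: e_def field_simps)
      ultimately show "(e has_real_derivative F i / \<epsilon> * ((h (x s) - h (xbar s)) $ i - \<epsilon> / F i * D s - e s)) (at s within {0..t})"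
        by simp
      have "\<bar>D s\<bar> \<le> norm (h' (xbar s) (reduced (xbar s)))"
        unfolding D_def by (rule component_le_norm_cart)
      also have "\<dots> \<le> Lh * norm (reduced (xbar s))" by (rule h'_bound)
      also have "\<dots> \<le> Lh * (KB * H)"
        unfolding reduced_def by (intro mult_left_mono Lh order_trans[OF B_bound] KB h_bound)
      finally have D: "\<epsilon> / F i * \<bar>D s\<bar> \<le> \<epsilon> / F i * (Lh * (KB * H))"
        using Fi \<open>0 < \<epsilon>\<close> by (intro mult_left_mono) auto
      have "\<bar>(h (x s) - h (xbar s)) $ i\<bar> \<le> norm (h (x s) - h (xbar s))" by (rule component_le_norm_cart)
      also have "\<dots> \<le> Lh * norm (x s - xbar s)" by (rule h_lip)
      also have "\<dots> \<le> Lh * (K * \<epsilon>)" using slow[of s] s Lh by (intro mult_left_mono) auto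
      finally have "\<bar>(h (x s) - h (xbar s)) $ i - \<epsilon> / F i * D s\<bar> \<le> Lh * (K * \<epsilon>) + \<epsilon> / F i * (Lh * (KB * H))"
        using D abs_triangle_ineq4[of "(h (x s) - h (xbar s)) $ i" "\<epsilon> / F i * D s"] Fi \<open>0 < \<epsilon>\<close>
        by (simp add: abs_mult)
      then show "\<bar>(h (x s) - h (xbar s)) $ i - \<epsilon> / F i * D s\<bar> \<le> (Lh * K + Lh * (KB * H) / F i) * \<epsilon>"
        by (simp add: algebra_simps)
    qed (use Fi \<open>0 < \<epsilon>\<close> \<open>0 \<le> t\<close> in auto)
    moreover have "e 0 = 0"
      using solution_initial[OF sol] xbar by (simp add: e_def layer_def ivp_solution_def)
    ultimately show "\<bar>(v t - h (xbar t) - layer x0 v0 (t / \<epsilon>)) $ i\<bar> \<le> (Lh * K + Lh * (KB * H) / F i) * \<epsilon>"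
      by (simp add: e_def)
  qed
  finally show ?thesis by (simp only: sum_distrib_right)
qed

text \<open>
  A small-gain argument over windows of length \<open>T\<close>. With \<open>A = |w - xs|\<close> and \<open>b = |v - h(xs)|\<close> at the
  beginning of a window, their values at its end are at most \<open>A/2 + c2 \<epsilon> (A + b)\<close> and
  \<open>c4 A + c5 \<epsilon> (A + b)\<close>. The coefficient \<open>c4\<close> need not be small, so the weight \<open>\<gamma>\<close> of \<open>b\<close> in the
  sum \<open>A + \<gamma> b\<close> is taken so small that \<open>\<gamma> c4 \<le> 1/8\<close>; then the sum decreases by the factor 3/4 for
  all small \<open>\<epsilon>\<close>.
\<close>

theorem local_exponential_decay:
  obtains \<rho> \<epsilon>3 where "0 < \<rho>" "0 < \<epsilon>3"
    "\<And>\<epsilon> x0 v0 x v a. 0 < \<epsilon> \<Longrightarrow> \<epsilon> < \<epsilon>3 \<Longrightarrow> solution \<epsilon> x0 v0 x v \<Longrightarrow> 0 \<le> a \<Longrightarrow>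
      (\<And>t. a \<le> t \<Longrightarrow> norm (x t - xs) \<le> \<rho> \<and> norm (x t + \<epsilon> *\<^sub>R lag (v t - h xs) - xs) \<le> \<rho>) \<Longrightarrow>
      converges_exponentially_to_zero (\<lambda>t. x t - xs) \<and> converges_exponentially_to_zero (\<lambda>t. v t - h xs)"
proof -
  obtain T C \<rho> where T: "0 < T" and C: "0 < C" and \<rho>: "0 < \<rho>" and contract:
    "\<And>a x w w' \<eta>. 0 \<le> \<eta> \<Longrightarrow>
      (\<And>t. t \<in> {a..a+T} \<Longrightarrow> (x has_vector_derivative reduced (x t)) (at t within {a..a+T})) \<Longrightarrow>
      (\<And>t. t \<in> {a..a+T} \<Longrightarrow> (w has_vector_derivative w' t) (at t within {a..a+T})) \<Longrightarrow>
      (\<And>t. t \<in> {a..a+T} \<Longrightarrow> norm (w' t - reduced (w t)) \<le> \<eta>) \<Longrightarrow>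
      (\<And>t. t \<in> {a..a+T} \<Longrightarrow> norm (x t - xs) \<le> \<rho> \<and> norm (w t - xs) \<le> \<rho>) \<Longrightarrow>
      norm (w (a + T) - x (a + T)) \<le> norm (w a - x a) / 2 + C * \<eta>"
    by (fact local_contraction)
  define N where "N = real CARD('n)"
  define L where "L = KB * Lh"
  define G where "G = exp ((L + 1) * T)"
  define kx where "kx = (G * L + 1) * Klag"
  define c1 where "c1 = 2 * N * (1 + Lh * G)"
  define c2 where "c2 = C * (L * Klag) * c1"
  define c3 where "c3 = (\<Sum>i\<in>UNIV. 1 / (F i * T))"
  define c4 where "c4 = N * (Lh * G)"
  define c5 where "c5 = N * (c3 + Lh * kx * c1)"
  define \<gamma> where "\<gamma> = 1 / (8 * (c4 + 1))"
  have N: "0 < N" by (simp add: N_def)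
  have L: "0 \<le> L" using KB Lh by (simp add: L_def)
  have G: "0 < G" by (simp add: G_def)
  have kx: "0 \<le> kx" using G L Klag by (simp add: kx_def)
  have c1: "0 \<le> c1" using N Lh G by (simp add: c1_def)
  have c2: "0 \<le> c2" using C L Klag c1 by (simp add: c2_def)
  have c3: "0 \<le> c3" unfolding c3_def using F T by (intro sum_nonneg) (simp add: less_imp_le)
  have c4: "0 \<le> c4" using N Lh G by (simp add: c4_def)
  have c5: "0 \<le> c5" using N Lh kx c1 c3 by (simp add: c5_def)
  have \<gamma>: "0 < \<gamma>" "\<gamma> \<le> 1" "\<gamma> * c4 \<le> 1 / 8"
    using c4 by (auto simp: \<gamma>_def field_simps)
  \<comment> \<open>The first bound absorbs the feedback of \<open>v\<close> on itself through \<open>x\<close> within one window, the second one makes the weighted sum decrease.\<close>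
  define \<epsilon>3 where "\<epsilon>3 = min (1 / (2 * N * Lh * kx + 1)) (\<gamma> / (8 * (c2 + c5 + 1)))"
  have \<epsilon>3: "0 < \<epsilon>3"
    using N Lh kx \<gamma> c2 c5 by (auto simp: \<epsilon>3_def intro!: add_nonneg_pos divide_pos_pos mult_nonneg_nonneg)
  show thesis
  proof (rule that[OF \<rho> \<epsilon>3])
    fix \<epsilon> x0 v0 x v and a :: real
    assume \<epsilon>: "0 < \<epsilon>" "\<epsilon> < \<epsilon>3" and sol: "solution \<epsilon> x0 v0 x v" and a: "0 \<le> a"
      and near: "\<And>t. a \<le> t \<Longrightarrow> norm (x t - xs) \<le> \<rho> \<and> norm (x t + \<epsilon> *\<^sub>R lag (v t - h xs) - xs) \<le> \<rho>"
    have \<epsilon>_a: "N * Lh * kx * \<epsilon> \<le> 1 / 2"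
    proof -
      have "\<epsilon> \<le> 1 / (2 * N * Lh * kx + 1)" using \<epsilon> by (simp add: \<epsilon>3_def)
      moreover have "0 < 2 * N * Lh * kx + 1" using N Lh kx by (simp add: add_nonneg_pos)
      ultimately have "\<epsilon> * (2 * N * Lh * kx + 1) \<le> 1" by (simp add: pos_le_divide_eq)
      then show ?thesis using \<epsilon> by (simp add: algebra_simps)
    qed
    have \<epsilon>_b: "(c2 + c5) * \<epsilon> \<le> \<gamma> / 8"
    proof -
      have "\<epsilon> \<le> \<gamma> / (8 * (c2 + c5 + 1))" using \<epsilon> by (simp add: \<epsilon>3_def)
      moreover have "0 < 8 * (c2 + c5 + 1)" using c2 c5 by simp
      ultimately have "\<epsilon> * (8 * (c2 + c5 + 1)) \<le> \<gamma>" by (simp only: pos_le_divide_eq)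
      then show ?thesis using \<epsilon> by (simp add: algebra_simps)
    qed
    define u where "u = (\<lambda>t. v t - h xs)"
    define w where "w = (\<lambda>t. x t + \<epsilon> *\<^sub>R lag (u t))"
    have window: "(\<forall>t\<in>{p..p+T}. norm (u t) \<le> c1 * (norm (w p - xs) + norm (u p)) \<and>
          norm (x t - xs) \<le> G * norm (w p - xs) + kx * \<epsilon> * (c1 * (norm (w p - xs) + norm (u p)))) \<and>
        norm (w (p + T) - xs) \<le> norm (w p - xs) / 2 + c2 * \<epsilon> * (norm (w p - xs) + norm (u p)) \<and>
        norm (u (p + T)) \<le> c4 * norm (w p - xs) + c5 * \<epsilon> * (norm (w p - xs) + norm (u p))"
      if p: "a \<le> p" for p
    proof -
      define A where "A = norm (w p - xs)"
      define b where "b = norm (u p)"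
      have Ab: "0 \<le> A" "0 \<le> b" by (auto simp: A_def b_def)
      have "continuous_on {p..p+T} (\<lambda>t. norm (u t))"
        unfolding u_def using solution_continuous(2)[OF sol] a p
        by (intro continuous_intros) (auto elim: continuous_on_subset)
      then obtain s where s: "s \<in> {p..p+T}" and smax: "\<And>t. t \<in> {p..p+T} \<Longrightarrow> norm (u t) \<le> norm (u s)"
        using continuous_attains_sup[of "{p..p+T}" "\<lambda>t. norm (u t)"] T by auto
      \<comment> \<open>All perturbations in the window are measured by the largest deviation \<open>U\<close>, which is then estimated by itself.\<close>
      define U where "U = norm (u s)"
      have U: "0 \<le> U" by (simp add: U_def)
      have xw: "norm (x t - w t) \<le> \<epsilon> * (Klag * U)" if "t \<in> {p..p+T}" for t
        using order_trans[OF lag_bound mult_left_mono[OF smax[OF that] Klag]] \<epsilon> by (simp add: w_def U_def)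
      have pert: "norm (reduced (x t) - reduced (w t)) \<le> L * (\<epsilon> * (Klag * U))" if "t \<in> {p..p+T}" for t
        using order_trans[OF reduced_lip mult_left_mono[OF xw[OF that] L[unfolded L_def]]] by (simp add: L_def)
      have w': "(w has_vector_derivative reduced (x t)) (at t within {q..r})" if "a \<le> q" "t \<in> {q..r}" for q r t
        unfolding w_def u_def
      proof (rule has_vector_derivative_within_subset)
        show "((\<lambda>t. x t + \<epsilon> *\<^sub>R lag (v t - h xs)) has_vector_derivative reduced (x t)) (at t within {0..})"
          using that a by (intro corrected_derivative[OF sol \<epsilon>(1)]) auto
      qed (use that a in auto)
      have rest: "((\<lambda>_. xs) has_vector_derivative reduced xs) (at t within S)" for t S
        by (simp add: fixed_point)
      have pert0: "0 \<le> L * (\<epsilon> * (Klag * U))" using L \<epsilon> Klag U by simp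
      have wt: "norm (w t - xs) \<le> G * (A + L * (\<epsilon> * (Klag * U)))" if t: "t \<in> {p..p+T}" for t
      proof -
        have "norm (w t - xs) \<le> exp ((L + 1) * (t - p)) * (norm (w p - xs) + L * (\<epsilon> * (Klag * U)))"
          unfolding L_def
          by (rule deviation_growth[OF rest w' pert[unfolded L_def] pert0[unfolded L_def]]) (use t p in auto)
        also have "\<dots> \<le> G * (A + L * (\<epsilon> * (Klag * U)))"
          unfolding G_def A_def using t L pert0 by (intro mult_right_mono) auto
        finally show ?thesis .
      qed
      have xt: "norm (x t - xs) \<le> G * A + kx * \<epsilon> * U" if t: "t \<in> {p..p+T}" for t
      proof -
        have "norm (x t - xs) \<le> norm (w t - xs) + norm (x t - w t)"
          using norm_triangle_ineq[of "w t - xs" "x t - w t"] by simp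
        also have "\<dots> \<le> G * (A + L * (\<epsilon> * (Klag * U))) + \<epsilon> * (Klag * U)"
          using wt[OF t] xw[OF t] by simp
        also have "\<dots> = G * A + kx * \<epsilon> * U" by (simp add: kx_def algebra_simps)
        finally show ?thesis .
      qed
      have ui: "\<bar>u t $ i\<bar> \<le> exp (- (F i / \<epsilon>) * (t - p)) * b + Lh * (G * A + kx * \<epsilon> * U)"
        if t: "t \<in> {p..p+T}" for t i
      proof -
        have "\<bar>u t $ i\<bar> \<le> exp (- (F i / \<epsilon>) * (t - p)) * \<bar>u p $ i\<bar> + Lh * (G * A + kx * \<epsilon> * U)"
        proof (rule relaxation_bound[where q = "\<lambda>r. (h (x r) - h xs) $ i"])
          fix r assume r: "r \<in> {p..t}"
          have "((\<lambda>r. v r $ i - h xs $ i) has_real_derivative F i / \<epsilon> * (h (x r) $ i - v r $ i) - 0) (at r within {p..t})"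
            by (intro DERIV_diff solution_component_derivative[OF sol _ r] DERIV_const) (use a p in simp)
          then show "((\<lambda>r. u r $ i) has_real_derivative F i / \<epsilon> * ((h (x r) - h xs) $ i - u r $ i)) (at r within {p..t})"
            by (simp add: u_def)
          have "\<bar>(h (x r) - h xs) $ i\<bar> \<le> Lh * norm (x r - xs)"
            by (rule order_trans[OF component_le_norm_cart h_lip])
          also have "\<dots> \<le> Lh * (G * A + kx * \<epsilon> * U)"
            using r t by (intro mult_left_mono xt Lh) auto
          finally show "\<bar>(h (x r) - h xs) $ i\<bar> \<le> Lh * (G * A + kx * \<epsilon> * U)" .
        qed (use F[of i] \<epsilon> t in auto)
        also have "exp (- (F i / \<epsilon>) * (t - p)) * \<bar>u p $ i\<bar> \<le> exp (- (F i / \<epsilon>) * (t - p)) * b"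
          unfolding b_def by (intro mult_left_mono component_le_norm_cart) auto
        finally show ?thesis by simp
      qed
      have Ub: "U \<le> c1 * (A + b)"
      proof -
        have "U \<le> N * (b + Lh * (G * A + kx * \<epsilon> * U))"
          unfolding U_def N_def
        proof (rule norm_vec_le_card)
          fix i
          have "exp (- (F i / \<epsilon>) * (s - p)) * b \<le> 1 * b"
            using F[of i] \<epsilon> s Ab by (intro mult_right_mono) auto
          then show "\<bar>u s $ i\<bar> \<le> b + Lh * (G * A + kx * \<epsilon> * norm (u s))"
            using ui[OF s, of i] by (simp add: U_def)
        qed
        also have "\<dots> = N * b + N * (Lh * G) * A + (N * Lh * kx * \<epsilon>) * U"
          by (simp add: algebra_simps)
        also have "\<dots> \<le> N * b + N * (Lh * G) * A + 1 / 2 * U"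
          using \<epsilon>_a U by (intro add_left_mono mult_right_mono) auto
        finally have "U \<le> 2 * N * b + 2 * N * (Lh * G) * A" by simp
        also have "\<dots> \<le> c1 * (A + b)"
          using N Lh G Ab by (simp add: c1_def algebra_simps)
        finally show ?thesis .
      qed
      have "norm (w (p + T) - xs) \<le> norm (w p - xs) / 2 + C * (L * (\<epsilon> * (Klag * U)))"
      proof (rule contract[OF pert0 rest w' pert])
        fix t assume "t \<in> {p..p+T}"
        then show "norm (xs - xs) \<le> \<rho> \<and> norm (w t - xs) \<le> \<rho>"
          using near[of t] p \<rho> by (auto simp: w_def u_def)
      qed (use p in auto)
      also have "C * (L * (\<epsilon> * (Klag * U))) \<le> C * (L * (\<epsilon> * (Klag * (c1 * (A + b)))))"
        using C L \<epsilon> Klag Ub by (intro mult_left_mono) auto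
      finally have 1: "norm (w (p + T) - xs) \<le> A / 2 + c2 * \<epsilon> * (A + b)"
        by (simp add: A_def c2_def mult_ac)
      have UE: "kx * \<epsilon> * U \<le> kx * \<epsilon> * (c1 * (A + b))"
        using kx \<epsilon> Ub by (intro mult_left_mono) auto
      have "norm (u (p + T)) \<le> N * (c3 * \<epsilon> * b + Lh * (G * A + kx * \<epsilon> * (c1 * (A + b))))"
        unfolding N_def
      proof (rule norm_vec_le_card)
        fix i
        have z: "0 < F i / \<epsilon> * T" using F[of i] \<epsilon> T by simp
        have "exp (- (F i / \<epsilon>) * (p + T - p)) = inverse (exp (F i / \<epsilon> * T))"
          by (simp flip: exp_minus)
        also have "\<dots> \<le> inverse (F i / \<epsilon> * T)"
          using z exp_ge_add_one_self[of "F i / \<epsilon> * T"] by (intro le_imp_inverse_le) linarith+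
        also have "\<dots> = 1 / (F i * T) * \<epsilon>" by (simp add: field_simps)
        also have "\<dots> \<le> c3 * \<epsilon>"
          unfolding c3_def using F T \<epsilon> by (intro mult_right_mono member_le_sum) (auto simp: less_imp_le)
        finally have "exp (- (F i / \<epsilon>) * (p + T - p)) * b \<le> c3 * \<epsilon> * b"
          using Ab by (intro mult_right_mono) auto
        moreover have "Lh * (G * A + kx * \<epsilon> * U) \<le> Lh * (G * A + kx * \<epsilon> * (c1 * (A + b)))"
          using UE by (intro mult_left_mono Lh) auto
        ultimately show "\<bar>u (p + T) $ i\<bar> \<le> c3 * \<epsilon> * b + Lh * (G * A + kx * \<epsilon> * (c1 * (A + b)))"
          using ui[of "p + T" i] T by simp
      qed
      also have "\<dots> \<le> c4 * A + c5 * \<epsilon> * (A + b)"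
      proof -
        have "0 \<le> N * (c3 * \<epsilon> * A)" using N c3 \<epsilon> Ab by simp
        then show ?thesis by (simp add: c4_def c5_def algebra_simps)
      qed
      finally have 2: "norm (u (p + T)) \<le> c4 * A + c5 * \<epsilon> * (A + b)" .
      have 3: "norm (u t) \<le> c1 * (A + b) \<and> norm (x t - xs) \<le> G * A + kx * \<epsilon> * (c1 * (A + b))"
        if "t \<in> {p..p+T}" for t
        using smax[OF that] Ub xt[OF that] UE by (simp add: U_def)
      show ?thesis using 1 2 3 by (simp add: A_def b_def)
    qed
    define q where "q = (\<lambda>p. norm (w p - xs) + \<gamma> * norm (u p))"
    have q_step: "q (p + T) \<le> 3 / 4 * q p" if p: "a \<le> p" for p
    proof -
      define A where "A = norm (w p - xs)"
      define b where "b = norm (u p)"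
      have Ab: "0 \<le> A" "0 \<le> b" by (auto simp: A_def b_def)
      have w1: "norm (w (p + T) - xs) \<le> A / 2 + c2 * \<epsilon> * (A + b)"
        and u1: "norm (u (p + T)) \<le> c4 * A + c5 * \<epsilon> * (A + b)"
        using window[OF p] by (auto simp: A_def b_def)
      have "\<gamma> * norm (u (p + T)) \<le> \<gamma> * (c4 * A + c5 * \<epsilon> * (A + b))"
        using u1 \<gamma> by (intro mult_left_mono) auto
      also have "\<dots> = (\<gamma> * c4) * A + \<gamma> * (c5 * \<epsilon> * (A + b))" by (simp add: algebra_simps)
      also have "\<dots> \<le> 1 / 8 * A + 1 * (c5 * \<epsilon> * (A + b))"
        using \<gamma> Ab c5 \<epsilon> by (intro add_mono mult_right_mono) auto
      finally have "q (p + T) \<le> 5 / 8 * A + (c2 + c5) * \<epsilon> * (A + b)"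
        using w1 by (simp add: q_def algebra_simps)
      also have "\<dots> \<le> 5 / 8 * A + \<gamma> / 8 * (A + b)"
        using \<epsilon>_b Ab by (intro add_left_mono mult_right_mono) auto
      also have "\<dots> = 5 / 8 * A + (\<gamma> * A) / 8 + (\<gamma> * b) / 8" by (simp add: field_simps)
      also have "\<dots> \<le> 3 / 4 * (A + \<gamma> * b)"
        using mult_right_mono[OF \<gamma>(2) Ab(1)] mult_nonneg_nonneg[OF less_imp_le[OF \<gamma>(1)] Ab(2)]
        unfolding distrib_left by linarith
      finally show ?thesis by (simp add: q_def A_def b_def)
    qed
    have q_grid: "q (a + real n * T) \<le> q a * (3 / 4) ^ n" for n
    proof (induction n)
      case (Suc n)
      have "q (a + real n * T + T) \<le> 3 / 4 * q (a + real n * T)"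
        by (rule q_step) (use T in simp)
      then show ?case using Suc by (simp add: algebra_simps)
    qed simp
    have sum_q: "norm (w p - xs) + norm (u p) \<le> q p / \<gamma>" for p
      using \<gamma> mult_right_mono[OF \<gamma>(2), of "norm (w p - xs)"]
      by (simp add: q_def pos_le_divide_eq algebra_simps)
    have grid: "norm (u t) \<le> c1 / \<gamma> * q a * (3 / 4) ^ n \<and>
        norm (x t - xs) \<le> (G + kx * \<epsilon> * c1) / \<gamma> * q a * (3 / 4) ^ n"
      if t: "t \<in> {a + real n * T..a + real n * T + T}" for n t
    proof -
      define p where "p = a + real n * T"
      have p: "a \<le> p" using T by (simp add: p_def)
      have S: "norm (w p - xs) + norm (u p) \<le> q a * (3 / 4) ^ n / \<gamma>"
        using order_trans[OF sum_q divide_right_mono[OF q_grid[of n, folded p_def]]] \<gamma> by simp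
      have 1: "norm (u t) \<le> c1 * (norm (w p - xs) + norm (u p))"
        and 2: "norm (x t - xs) \<le> G * norm (w p - xs) + kx * \<epsilon> * (c1 * (norm (w p - xs) + norm (u p)))"
        using window[OF p] t by (auto simp: p_def)
      note 2
      also have "G * norm (w p - xs) + kx * \<epsilon> * (c1 * (norm (w p - xs) + norm (u p)))
          \<le> (G + kx * \<epsilon> * c1) * (norm (w p - xs) + norm (u p))"
        using G by (simp add: algebra_simps)
      also have "\<dots> \<le> (G + kx * \<epsilon> * c1) * (q a * (3 / 4) ^ n / \<gamma>)"
        using S G kx \<epsilon> c1 by (intro mult_left_mono) auto
      finally show ?thesis
        using order_trans[OF 1 mult_left_mono[OF S c1]] by simp
    qed
    show "converges_exponentially_to_zero (\<lambda>t. x t - xs) \<and> converges_exponentially_to_zero (\<lambda>t. v t - h xs)"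
    proof
      show "converges_exponentially_to_zero (\<lambda>t. x t - xs)"
        by (rule converges_exponentially_from_grid[where q = "3 / 4", OF _ T a _ _ conjunct2[OF grid]])
           (use solution_continuous(1)[OF sol] in \<open>auto intro!: continuous_intros\<close>)
      show "converges_exponentially_to_zero (\<lambda>t. v t - h xs)"
        by (rule converges_exponentially_from_grid[where q = "3 / 4", OF _ T a _ _ conjunct1[OF grid, unfolded u_def]])
           (use solution_continuous(2)[OF sol] in \<open>auto intro!: continuous_intros\<close>)
    qed
  qed
qed

text \<open>
  The uniform approximation keeps \<open>x\<close> within \<open>\<rho>/3\<close> of the reduced solution, which after a finite time
  is within \<open>\<rho>/3\<close> of \<open>xs\<close>; the correction term takes up the last third. From then on both solutions
  converge exponentially to the same equilibrium.
\<close>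

theorem exponential_approximation:
  assumes "compact \<Omega>" "\<Omega> \<subseteq> region_of_attraction reduced xs" "0 \<le> V"
  obtains \<epsilon>3 where "0 < \<epsilon>3"
    "\<And>\<epsilon> x0 v0 x v xbar. 0 < \<epsilon> \<Longrightarrow> \<epsilon> < \<epsilon>3 \<Longrightarrow> x0 \<in> \<Omega> \<Longrightarrow> norm v0 \<le> V \<Longrightarrow> solution \<epsilon> x0 v0 x v \<Longrightarrow>
       ivp_solution reduced x0 xbar \<Longrightarrow>
       converges_exponentially_to_zero (\<lambda>t. x t - xbar t) \<and>
       converges_exponentially_to_zero (\<lambda>t. v t - h (xbar t))"
proof -
  obtain \<rho> \<epsilon>l where \<rho>: "0 < \<rho>" and \<epsilon>l: "0 < \<epsilon>l" and decay:
    "\<And>\<epsilon> x0 v0 x v a. 0 < \<epsilon> \<Longrightarrow> \<epsilon> < \<epsilon>l \<Longrightarrow> solution \<epsilon> x0 v0 x v \<Longrightarrow> 0 \<le> a \<Longrightarrow>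
      (\<And>t. a \<le> t \<Longrightarrow> norm (x t - xs) \<le> \<rho> \<and> norm (x t + \<epsilon> *\<^sub>R lag (v t - h xs) - xs) \<le> \<rho>) \<Longrightarrow>
      converges_exponentially_to_zero (\<lambda>t. x t - xs) \<and> converges_exponentially_to_zero (\<lambda>t. v t - h xs)"
    by (fact local_exponential_decay)
  obtain K \<epsilon>1 where K: "0 < K" and \<epsilon>1: "0 < \<epsilon>1" and slow:
    "\<And>\<epsilon> x0 v0 x v xbar t. 0 < \<epsilon> \<Longrightarrow> \<epsilon> < \<epsilon>1 \<Longrightarrow> x0 \<in> \<Omega> \<Longrightarrow> norm v0 \<le> V \<Longrightarrow> solution \<epsilon> x0 v0 x v \<Longrightarrow>
       ivp_solution reduced x0 xbar \<Longrightarrow> 0 \<le> t \<Longrightarrow> norm (x t - xbar t) \<le> K * \<epsilon>"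
    by (fact slow_approximation[OF assms])
  obtain T0 where T0: "0 \<le> T0" and entry:
    "\<And>x0 x t. x0 \<in> \<Omega> \<Longrightarrow> ivp_solution reduced x0 x \<Longrightarrow> T0 \<le> t \<Longrightarrow> norm (x t - xs) \<le> \<rho> / 3"
    by (rule uniform_entry_time[OF assms(1,2), of "\<rho> / 3"]) (use \<rho> in auto)
  define c where "c = Klag * (real CARD('n) * (V + H) + H) + 1"
  have H: "0 \<le> H" using order_trans[OF norm_ge_zero h_bound] .
  have c: "0 < c" using Klag H assms(3) by (simp add: c_def add_nonneg_pos)
  define \<epsilon>3 where "\<epsilon>3 = Min {\<epsilon>l, \<epsilon>1, \<rho> / (3 * K), \<rho> / (3 * c)}"
  show thesis
  proof (rule that[of \<epsilon>3])
    show "0 < \<epsilon>3" using \<epsilon>l \<epsilon>1 \<rho> K c by (simp add: \<epsilon>3_def)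
    fix \<epsilon> x0 v0 x v xbar
    assume \<epsilon>: "0 < \<epsilon>" "\<epsilon> < \<epsilon>3" and x0: "x0 \<in> \<Omega>" and v0: "norm v0 \<le> V"
      and sol: "solution \<epsilon> x0 v0 x v" and xbar: "ivp_solution reduced x0 xbar"
    have \<epsilon>': "\<epsilon> < \<epsilon>l" "\<epsilon> < \<epsilon>1" "K * \<epsilon> \<le> \<rho> / 3" "c * \<epsilon> \<le> \<rho> / 3"
      using \<epsilon> K c by (auto simp: \<epsilon>3_def field_simps)
    have near: "norm (x t - xs) \<le> \<rho> \<and> norm (x t + \<epsilon> *\<^sub>R lag (v t - h xs) - xs) \<le> \<rho>" if t: "T0 \<le> t" for t
    proof -
      have "norm (x t - xs) \<le> norm (x t - xbar t) + norm (xbar t - xs)"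
        using norm_triangle_ineq[of "x t - xbar t" "xbar t - xs"] by simp
      also have "\<dots> \<le> \<rho> / 3 + \<rho> / 3"
        using slow[OF \<epsilon>(1) \<epsilon>'(2) x0 v0 sol xbar, of t] entry[OF x0 xbar t] \<epsilon>'(3) t T0 by simp
      finally have 1: "norm (x t - xs) \<le> \<rho> / 3 + \<rho> / 3" .
      have "norm (v t - h xs) \<le> real CARD('n) * (V + H) + H"
        using solution_v_bound[OF sol \<epsilon>(1) v0, of t] h_bound[of xs] norm_triangle_ineq4[of "v t" "h xs"] t T0 by simp
      then have "norm (lag (v t - h xs)) \<le> c"
        using order_trans[OF lag_bound mult_left_mono[OF _ Klag]] by (fastforce simp: c_def)
      then have "norm (\<epsilon> *\<^sub>R lag (v t - h xs)) \<le> c * \<epsilon>"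
        using \<epsilon> by (simp add: mult.commute mult_right_mono)
      then have "norm (x t + \<epsilon> *\<^sub>R lag (v t - h xs) - xs) \<le> \<rho>"
        using norm_triangle_ineq[of "x t - xs" "\<epsilon> *\<^sub>R lag (v t - h xs)"] 1 \<epsilon>'(4) by (simp add: algebra_simps)
      then show ?thesis using 1 \<rho> by simp
    qed
    have x_lim: "converges_exponentially_to_zero (\<lambda>t. x t - xs)"
      and v_lim: "converges_exponentially_to_zero (\<lambda>t. v t - h xs)"
      using decay[OF \<epsilon>(1) \<epsilon>'(1) sol T0 near] by auto
    have xbar_lim: "converges_exponentially_to_zero (\<lambda>t. xbar t - xs)"
      by (rule region_of_attraction_exponential[OF subsetD[OF assms(2) x0] xbar])
    have h_lim: "converges_exponentially_to_zero (\<lambda>t. h (xbar t) - h xs)"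
      by (rule converges_exponentially_lipschitz[OF xbar_lim h_lip])
    show "converges_exponentially_to_zero (\<lambda>t. x t - xbar t) \<and> converges_exponentially_to_zero (\<lambda>t. v t - h (xbar t))"
      using converges_exponentially_diff[OF x_lim xbar_lim] converges_exponentially_diff[OF v_lim h_lim] by simp
  qed
qed

end

section \<open>The power network model\<close>

lemma cos_lipschitz: "\<bar>cos x - cos y\<bar> \<le> \<bar>x - y\<bar>" for x y :: real
proof -
  have "norm (cos x - cos y) \<le> 1 * norm (x - y)"
    by (rule field_differentiable_bound[of UNIV _ "\<lambda>x. - sin x"]) (auto intro!: derivative_eq_intros)
  then show ?thesis by simp
qed

lemma grounded_bounded_linear: "bounded_linear (\<lambda>\<delta>. grounded \<delta> i)"
  by (cases i) (auto simp: grounded_def bounded_linear_vec_nth)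

lemma grounded_le_norm: "\<bar>grounded \<delta> i\<bar> \<le> norm \<delta>"
  by (cases i) (auto simp: grounded_def component_le_norm_cart)

lemma grounded_diff: "grounded (\<delta> - \<xi>) i = grounded \<delta> i - grounded \<xi> i"
  by (cases i) (auto simp: grounded_def)

lemma phase_difference_le: "\<bar>grounded \<xi> i - grounded \<xi> j\<bar> \<le> 2 * norm \<xi>"
  using grounded_le_norm[of \<xi> i] grounded_le_norm[of \<xi> j] by linarith

definition relative_freq :: "real ^ 'm::finite option \<Rightarrow> real ^ 'm" where
  "relative_freq v = (\<chi> k. v $ Some k - v $ None)"

lemma relative_freq_bounded_linear: "bounded_linear relative_freq"
proof -
  have "linear (relative_freq :: real ^ 'm::finite option \<Rightarrow> real ^ 'm)"
    by (rule linearI) (simp_all add: relative_freq_def vec_eq_iff algebra_simps)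
  then show ?thesis by (rule linear_conv_bounded_linear[THEN iffD1])
qed

text \<open>
  Derivatives of \<open>h\<close> and differences of such derivatives have this shape, with cosines or differences
  of cosines as coefficients \<open>c\<close>; one estimate serves both.
\<close>

definition coupling_form :: "('m::finite option \<Rightarrow> real) \<Rightarrow> ('m option \<Rightarrow> 'm option \<Rightarrow> real) \<Rightarrow>
    ('m option \<Rightarrow> 'm option \<Rightarrow> real) \<Rightarrow> real ^ 'm \<Rightarrow> real ^ 'm option" where
  "coupling_form D P c \<xi> = (\<chi> i. - (\<Sum>j\<in>UNIV. P i j * (c i j * (grounded \<xi> i - grounded \<xi> j))) / D i)"

definition h_deriv :: "('m::finite option \<Rightarrow> real) \<Rightarrow> ('m option \<Rightarrow> 'm option \<Rightarrow> real) \<Rightarrow>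
    ('m option \<Rightarrow> 'm option \<Rightarrow> real) \<Rightarrow> real ^ 'm \<Rightarrow> real ^ 'm \<Rightarrow> real ^ 'm option" where
  "h_deriv D P \<phi> \<delta> = coupling_form D P (\<lambda>i j. cos (grounded \<delta> i - grounded \<delta> j + \<phi> i j))"

definition coupling_strength :: "('m::finite option \<Rightarrow> real) \<Rightarrow> ('m option \<Rightarrow> 'm option \<Rightarrow> real) \<Rightarrow> real" where
  "coupling_strength D P = (\<Sum>i\<in>UNIV. (\<Sum>j\<in>UNIV. P i j) / D i)"

context
  fixes D :: "'m::finite option \<Rightarrow> real" and P :: "'m option \<Rightarrow> 'm option \<Rightarrow> real"
  assumes D: "\<And>i. 0 < D i" and P: "\<And>i j. 0 \<le> P i j"
begin

lemma coupling_strength_nonneg: "0 \<le> coupling_strength D P"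
  unfolding coupling_strength_def using D P by (intro sum_nonneg divide_nonneg_pos) auto

lemma coupling_form_bound:
  assumes c: "\<And>i j. \<bar>c i j\<bar> \<le> \<kappa>"
  shows "norm (coupling_form D P c \<xi>) \<le> 2 * coupling_strength D P * \<kappa> * norm \<xi>"
proof -
  have "norm (coupling_form D P c \<xi>) \<le> (\<Sum>i\<in>UNIV. \<bar>coupling_form D P c \<xi> $ i\<bar>)"
    by (rule norm_le_l1_cart)
  also have "\<dots> \<le> (\<Sum>i\<in>UNIV. (\<Sum>j\<in>UNIV. P i j) / D i * (\<kappa> * (2 * norm \<xi>)))"
  proof (rule sum_mono)
    fix i
    have "\<bar>\<Sum>j\<in>UNIV. P i j * (c i j * (grounded \<xi> i - grounded \<xi> j))\<bar>
        \<le> (\<Sum>j\<in>UNIV. \<bar>P i j * (c i j * (grounded \<xi> i - grounded \<xi> j))\<bar>)"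
      by (rule sum_abs)
    also have "\<dots> \<le> (\<Sum>j\<in>UNIV. P i j * (\<kappa> * (2 * norm \<xi>)))"
    proof (rule sum_mono)
      fix j
      have "0 \<le> \<kappa>" using order_trans[OF abs_ge_zero c] .
      then show "\<bar>P i j * (c i j * (grounded \<xi> i - grounded \<xi> j))\<bar> \<le> P i j * (\<kappa> * (2 * norm \<xi>))"
        using P[of i j] c[of i j] phase_difference_le[of \<xi> i j]
        unfolding abs_mult by (intro mult_mono) auto
    qed
    finally have "\<bar>\<Sum>j\<in>UNIV. P i j * (c i j * (grounded \<xi> i - grounded \<xi> j))\<bar> / D i
        \<le> (\<Sum>j\<in>UNIV. P i j) * (\<kappa> * (2 * norm \<xi>)) / D i"
      using D[of i] by (intro divide_right_mono) (auto simp: sum_distrib_right)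
    then show "\<bar>coupling_form D P c \<xi> $ i\<bar> \<le> (\<Sum>j\<in>UNIV. P i j) / D i * (\<kappa> * (2 * norm \<xi>))"
      using D[of i] by (simp add: coupling_form_def)
  qed
  also have "\<dots> = 2 * coupling_strength D P * \<kappa> * norm \<xi>"
    unfolding coupling_strength_def sum_distrib_right[symmetric] by simp
  finally show ?thesis .
qed

lemma h_bounded:
  "norm (h D \<omega> P \<phi> \<delta>) \<le> (\<Sum>i\<in>UNIV. (\<bar>\<omega> i\<bar> + (\<Sum>j\<in>UNIV. P i j)) / D i)"
proof -
  have "norm (h D \<omega> P \<phi> \<delta>) \<le> (\<Sum>i\<in>UNIV. \<bar>h D \<omega> P \<phi> \<delta> $ i\<bar>)"
    by (rule norm_le_l1_cart)
  also have "\<dots> \<le> (\<Sum>i\<in>UNIV. (\<bar>\<omega> i\<bar> + (\<Sum>j\<in>UNIV. P i j)) / D i)"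
  proof (rule sum_mono)
    fix i
    have "\<bar>\<Sum>j\<in>UNIV. P i j * sin (grounded \<delta> i - grounded \<delta> j + \<phi> i j)\<bar>
        \<le> (\<Sum>j\<in>UNIV. \<bar>P i j * sin (grounded \<delta> i - grounded \<delta> j + \<phi> i j)\<bar>)"
      by (rule sum_abs)
    also have "\<dots> \<le> (\<Sum>j\<in>UNIV. P i j)"
      using P by (intro sum_mono) (simp add: abs_mult mult_left_le)
    finally have "\<bar>Q \<omega> P \<phi> \<delta> i\<bar> \<le> \<bar>\<omega> i\<bar> + (\<Sum>j\<in>UNIV. P i j)"
      unfolding Q_def by linarith
    then show "\<bar>h D \<omega> P \<phi> \<delta> $ i\<bar> \<le> (\<bar>\<omega> i\<bar> + (\<Sum>j\<in>UNIV. P i j)) / D i"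
      using D[of i] by (simp add: h_def divide_right_mono)
  qed
  finally show ?thesis .
qed

lemma h_has_derivative: "(h D \<omega> P \<phi> has_derivative h_deriv D P \<phi> \<delta>) (at \<delta>)"
proof -
  have g: "((\<lambda>x. grounded x i) has_derivative (\<lambda>\<xi>. grounded \<xi> i)) (at \<delta>)" for i
    by (rule bounded_linear_imp_has_derivative[OF grounded_bounded_linear])
  have "((\<lambda>x. h D \<omega> P \<phi> x $ i) has_derivative (\<lambda>\<xi>. h_deriv D P \<phi> \<delta> \<xi> $ i)) (at \<delta>)" for i
    unfolding h_def Q_def h_deriv_def coupling_form_def vec_lambda_beta
    using D[of i]
    by (auto intro!: derivative_eq_intros g simp: fun_eq_iff algebra_simps)
  then show ?thesis
    by (subst has_derivative_componentwise_within) (auto simp: Basis_vec_def inner_axis)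
qed

lemma h_deriv_bound: "norm (h_deriv D P \<phi> \<delta> \<xi>) \<le> 2 * coupling_strength D P * norm \<xi>"
  using coupling_form_bound[of "\<lambda>i j. cos (grounded \<delta> i - grounded \<delta> j + \<phi> i j)" 1 \<xi>]
  by (simp add: h_deriv_def)

lemma h_deriv_lipschitz:
  "norm (h_deriv D P \<phi> \<delta> \<xi> - h_deriv D P \<phi> \<delta>' \<xi>) \<le> 4 * coupling_strength D P * norm (\<delta> - \<delta>') * norm \<xi>"
proof -
  define c where "c = (\<lambda>i j. cos (grounded \<delta> i - grounded \<delta> j + \<phi> i j) - cos (grounded \<delta>' i - grounded \<delta>' j + \<phi> i j))"
  have "\<bar>c i j\<bar> \<le> 2 * norm (\<delta> - \<delta>')" for i j
    using cos_lipschitz[of "grounded \<delta> i - grounded \<delta> j + \<phi> i j" "grounded \<delta>' i - grounded \<delta>' j + \<phi> i j"]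
      phase_difference_le[of "\<delta> - \<delta>'" i j]
    by (simp add: c_def grounded_diff)
  from coupling_form_bound[of c, OF this]
  have "norm (coupling_form D P c \<xi>) \<le> 4 * coupling_strength D P * norm (\<delta> - \<delta>') * norm \<xi>" by (simp add: mult.assoc)
  moreover have "h_deriv D P \<phi> \<delta> \<xi> - h_deriv D P \<phi> \<delta>' \<xi> = coupling_form D P c \<xi>"
    by (simp add: h_deriv_def coupling_form_def c_def vec_eq_iff sum_subtractf left_diff_distrib right_diff_distrib
        add_divide_distrib diff_divide_distrib)
  ultimately show ?thesis by simp
qed

lemma slow_fast_kuramoto:
  assumes F: "\<And>i. 0 < F i"
  shows "slow_fast relative_freq F (h D \<omega> P \<phi>) (h_deriv D P \<phi>)
    (\<Sum>i\<in>UNIV. (\<bar>\<omega> i\<bar> + (\<Sum>j\<in>UNIV. P i j)) / D i) (2 * coupling_strength D P) (4 * coupling_strength D P)"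
  by (rule slow_fast.intro)
     (auto intro: relative_freq_bounded_linear F h_bounded h_has_derivative h_deriv_bound h_deriv_lipschitz
        coupling_strength_nonneg)

end

text \<open>
  The term \<open>j = i\<close>, which the sum in the grounded model omits, is split: its first part vanishes since
  \<open>P i i = 0\<close>, and its second part is the last summand of the model. Symmetry of \<open>P\<close> and \<open>\<phi>\<close> identifies
  the terms that involve the grounded node.
\<close>

lemma grounded_kuramoto_eq_relative_freq:
  assumes P: "coupling_weights P" and \<phi>: "phase_shifts \<phi>"
  shows "grounded_kuramoto D \<omega> P \<phi> \<delta> = relative_freq (h D \<omega> P \<phi> \<delta>)"
proof -
  have Psym: "P i j = P j i" and P0: "P i i = 0" and \<phi>sym: "\<phi> i j = \<phi> j i" for i j
    using P \<phi> by (auto simp: coupling_weights_def phase_shifts_def)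
  have split: "(\<Sum>j\<in>UNIV. f j) = f None + (\<Sum>k\<in>UNIV. f (Some k))" for f :: "'a option \<Rightarrow> real"
    by (simp add: UNIV_option_conv sum.reindex)
  have "grounded_kuramoto D \<omega> P \<phi> \<delta> $ i = relative_freq (h D \<omega> P \<phi> \<delta>) $ i" for i
  proof -
    define a where "a = (\<lambda>j. P (Some i) (Some j) / D (Some i) * sin (\<delta> $ i - \<delta> $ j + \<phi> (Some i) (Some j)))"
    define b where "b = (\<lambda>j. P None (Some j) / D None * sin (\<delta> $ j - \<phi> (Some j) None))"
    have ai: "a i = 0" by (simp add: a_def P0)
    have Qi: "Q \<omega> P \<phi> \<delta> (Some i) / D (Some i) =
        \<omega> (Some i) / D (Some i) - P (Some i) None / D (Some i) * sin (\<delta> $ i + \<phi> (Some i) None) - (\<Sum>j\<in>UNIV. a j)"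
      by (simp add: Q_def split grounded_def a_def diff_divide_distrib add_divide_distrib sum_divide_distrib)
    have neg: "sin (\<phi> None (Some k) - \<delta> $ k) = - sin (\<delta> $ k - \<phi> (Some k) None)" for k
      using sin_minus[of "\<delta> $ k - \<phi> (Some k) None"] \<phi>sym[of None "Some k"] by simp
    have Qn: "Q \<omega> P \<phi> \<delta> None / D None = \<omega> None / D None + (\<Sum>j\<in>UNIV. b j)"
      by (simp add: Q_def split grounded_def b_def P0 neg add_divide_distrib diff_divide_distrib sum_divide_distrib sum_negf)
    have "(\<Sum>j\<in>UNIV - {i}. a j + b j) = (\<Sum>j\<in>UNIV. a j) + (\<Sum>j\<in>UNIV. b j) - b i"
      by (simp add: sum_diff1 sum.distrib ai)
    then show ?thesis
      using Qi Qn Psym[of "Some i" None]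
      by (simp add: grounded_kuramoto_def relative_freq_def h_def flip: a_def b_def)
         (simp add: a_def b_def)
  qed
  then show ?thesis by (simp add: vec_eq_iff)
qed

lemma F_coeff_pos:
  assumes "\<forall>i. M i > 0" "\<forall>i. D i > 0"
  shows "0 < F_coeff M D i"
proof -
  have "0 < Min (range D)" using assms by simp
  moreover have "0 < Max (range M)" using assms by (subst Max_gr_iff) auto
  ultimately show ?thesis using assms by (simp add: F_coeff_def)
qed

lemma SP_solution_iff:
  assumes "slow_fast relative_freq F (h D \<omega> P \<phi>) h' H L L2" and "\<And>i. D i \<noteq> 0"
  shows "SP_solution F D \<omega> P \<phi> \<epsilon> \<delta>0 v0 \<delta> v \<longleftrightarrow>
    slow_fast.solution relative_freq F (h D \<omega> P \<phi>) \<epsilon> \<delta>0 v0 \<delta> v"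
proof -
  interpret slow_fast relative_freq F "h D \<omega> P \<phi>" h' H L L2 by fact
  have rhs: "(- F i * v t $ i + F i / D i * Q \<omega> P \<phi> (\<delta> t) i) / \<epsilon> =
      (\<chi> i. F i / \<epsilon> * (h D \<omega> P \<phi> (\<delta> t) $ i - v t $ i)) $ i" for t i
    by (simp add: h_def right_diff_distrib diff_divide_distrib)
  have \<delta>: "(\<forall>i. ((\<lambda>s. \<delta> s $ i) has_real_derivative v t $ Some i - v t $ None) (at t within {0..})) \<longleftrightarrow>
      (\<delta> has_vector_derivative relative_freq (v t)) (at t within {0..})" for t
    by (simp add: has_vector_derivative_vec_iff relative_freq_def)
  show ?thesis
  proof
    assume sp: "SP_solution F D \<omega> P \<phi> \<epsilon> \<delta>0 v0 \<delta> v"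
    show "solution \<epsilon> \<delta>0 v0 \<delta> v"
      unfolding solution_def ivp_solution_def field_def
    proof (intro conjI allI impI)
      show "(\<delta> 0, v 0) = (\<delta>0, v0)" using sp by (simp add: SP_solution_def)
      fix t :: real assume "0 \<le> t"
      then show "((\<lambda>t. (\<delta> t, v t)) has_vector_derivative (case (\<delta> t, v t) of (x, v) \<Rightarrow>
          (relative_freq v, \<chi> i. F i / \<epsilon> * (h D \<omega> P \<phi> x $ i - v $ i)))) (at t within {0..})"
        using sp unfolding SP_solution_def rhs \<delta> has_vector_derivative_vec_iff[symmetric] prod.case
        by (intro has_vector_derivative_Pair) auto
    qed
  next
    assume sol: "solution \<epsilon> \<delta>0 v0 \<delta> v"
    show "SP_solution F D \<omega> P \<phi> \<epsilon> \<delta>0 v0 \<delta> v"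
      unfolding SP_solution_def rhs \<delta> has_vector_derivative_vec_iff[symmetric]
      using solution_derivatives[OF sol] solution_initial[OF sol] by auto
  qed
qed

theorem mainTheorem2:
  fixes M D \<omega> :: "'m::finite option \<Rightarrow> real"
    and P :: "'m option \<Rightarrow> 'm option \<Rightarrow> real"
    and F :: "'m option \<Rightarrow> real"
  assumes "\<forall>i. M i > 0" and "\<forall>i. D i > 0" and "coupling_weights P"
    and "F = F_coeff M D"
  shows "\<exists>\<phi>_bar>0. \<forall>\<phi> \<delta>_inf \<Omega> V.
    phase_shifts \<phi> \<longrightarrow>
    exponentially_stable_fixed_point (grounded_kuramoto D \<omega> P \<phi>) \<delta>_inf \<longrightarrow>
    compact \<Omega> \<longrightarrow> \<Omega> \<subseteq> region_of_attraction (grounded_kuramoto D \<omega> P \<phi>) \<delta>_inf \<longrightarrow>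
    bounded V \<longrightarrow>
    (\<exists>\<epsilon>1>0.
      (\<exists>K. \<forall>\<epsilon>. 0 < \<epsilon> \<and> \<epsilon> < \<epsilon>1 \<longrightarrow> (\<forall>\<delta>0\<in>\<Omega>. \<forall>v0\<in>V.
         SP_has_unique_solution F D \<omega> P \<phi> \<epsilon> \<delta>0 v0 \<and>
         (\<forall>\<delta> v \<delta>_bar. SP_solution F D \<omega> P \<phi> \<epsilon> \<delta>0 v0 \<delta> v \<longrightarrow>
            ivp_solution (grounded_kuramoto D \<omega> P \<phi>) \<delta>0 \<delta>_bar \<longrightarrow>
            (\<forall>t\<ge>0.
               norm (\<delta> t - \<delta>_bar t) \<le> K * \<epsilon> \<and>
               norm (v t - h D \<omega> P \<phi> (\<delta>_bar t)
                     - boundary_layer F D \<omega> P \<phi> \<delta>0 v0 (t / \<epsilon>)) \<le> K * \<epsilon>))))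
      \<and>
      (\<forall>t_b>0. \<exists>\<epsilon>2>0. \<epsilon>2 \<le> \<epsilon>1 \<and>
        (\<exists>K. \<forall>\<epsilon>. 0 < \<epsilon> \<and> \<epsilon> < \<epsilon>2 \<longrightarrow> (\<forall>\<delta>0\<in>\<Omega>. \<forall>v0\<in>V.
           \<forall>\<delta> v \<delta>_bar. SP_solution F D \<omega> P \<phi> \<epsilon> \<delta>0 v0 \<delta> v \<longrightarrow>
              ivp_solution (grounded_kuramoto D \<omega> P \<phi>) \<delta>0 \<delta>_bar \<longrightarrow>
              (\<forall>t\<ge>t_b. norm (v t - h D \<omega> P \<phi> (\<delta>_bar t)) \<le> K * \<epsilon>))))
      \<and>
      (phi_max \<phi> < \<phi>_bar \<longrightarrow> (\<exists>\<epsilon>3>0. \<epsilon>3 \<le> \<epsilon>1 \<and>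
        (\<forall>\<epsilon>. 0 < \<epsilon> \<and> \<epsilon> < \<epsilon>3 \<longrightarrow> (\<forall>\<delta>0\<in>\<Omega>. \<forall>v0\<in>V.
           \<forall>\<delta> v \<delta>_bar. SP_solution F D \<omega> P \<phi> \<epsilon> \<delta>0 v0 \<delta> v \<longrightarrow>
              ivp_solution (grounded_kuramoto D \<omega> P \<phi>) \<delta>0 \<delta>_bar \<longrightarrow>
              converges_exponentially_to_zero (\<lambda>t. \<delta> t - \<delta>_bar t) \<and>
              converges_exponentially_to_zero (\<lambda>t. v t - h D \<omega> P \<phi> (\<delta>_bar t)
                - boundary_layer F D \<omega> P \<phi> \<delta>0 v0 (t / \<epsilon>)) \<and>
              converges_exponentially_to_zero (\<lambda>t. v t - h D \<omega> P \<phi> (\<delta>_bar t)))))))"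
proof (rule exI[of _ 1], intro conjI allI impI, goal_cases)
  case (2 \<phi> \<delta>_inf \<Omega> V)
  note \<phi> = 2(1) and stable = 2(2) and \<Omega> = 2(3,4)
  have D: "0 < D i" for i using assms(2) by simp
  have P: "0 \<le> P i j" for i j
    using assms(3) by (cases "i = j") (auto simp: coupling_weights_def less_imp_le)
  define S where "S = coupling_strength D P"
  define H where "H = (\<Sum>i\<in>UNIV. (\<bar>\<omega> i\<bar> + (\<Sum>j\<in>UNIV. P i j)) / D i)"
  have sf: "slow_fast relative_freq F (h D \<omega> P \<phi>) (h_deriv D P \<phi>) H (2 * S) (4 * S)"
    unfolding S_def H_def assms(4) by (rule slow_fast_kuramoto[OF D P F_coeff_pos[OF assms(1,2)]])
  have gk: "grounded_kuramoto D \<omega> P \<phi> = slow_fast.reduced relative_freq (h D \<omega> P \<phi>)"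
    using grounded_kuramoto_eq_relative_freq[OF assms(3) \<phi>]
    by (simp add: slow_fast.reduced_def[OF sf] fun_eq_iff)
  interpret stable_slow_fast relative_freq F "h D \<omega> P \<phi>" "h_deriv D P \<phi>" H "2 * S" "4 * S" \<delta>_inf
    by (intro stable_slow_fast.intro stable_slow_fast_axioms.intro sf stable[unfolded gk])
  have SP: "SP_solution F D \<omega> P \<phi> \<epsilon> \<delta>0 v0 \<delta> v \<longleftrightarrow> solution \<epsilon> \<delta>0 v0 \<delta> v" for \<epsilon> \<delta>0 v0 \<delta> v
    using SP_solution_iff[OF sf] D by (simp add: less_imp_neq[symmetric])
  have layer: "boundary_layer F D \<omega> P \<phi> \<delta>0 v0 = layer \<delta>0 v0" for \<delta>0 v0
    by (simp add: boundary_layer_def layer_def fun_eq_iff)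
  have unique: "SP_has_unique_solution F D \<omega> P \<phi> \<epsilon> \<delta>0 v0" if "0 < \<epsilon>" for \<epsilon> \<delta>0 v0
    using solution_exists[OF that] solution_unique[OF that]
    unfolding SP_has_unique_solution_def SP by metis
  obtain W where W: "0 \<le> W" "\<And>v. v \<in> V \<Longrightarrow> norm v \<le> W"
    using 2(5) by (metis bounded_pos less_imp_le)
  obtain K \<epsilon>1 where \<epsilon>1: "0 < \<epsilon>1" and "0 < K" and slow:
    "\<And>\<epsilon> x0 v0 x v xbar t. 0 < \<epsilon> \<Longrightarrow> \<epsilon> < \<epsilon>1 \<Longrightarrow> x0 \<in> \<Omega> \<Longrightarrow> norm v0 \<le> W \<Longrightarrow> solution \<epsilon> x0 v0 x v \<Longrightarrow>
       ivp_solution reduced x0 xbar \<Longrightarrow> 0 \<le> t \<Longrightarrow> norm (x t - xbar t) \<le> K * \<epsilon>"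
    by (rule slow_approximation[OF \<Omega>[unfolded gk] W(1)]) blast
  obtain \<epsilon>e where \<epsilon>e: "0 < \<epsilon>e" and expo:
    "\<And>\<epsilon> x0 v0 x v xbar. 0 < \<epsilon> \<Longrightarrow> \<epsilon> < \<epsilon>e \<Longrightarrow> x0 \<in> \<Omega> \<Longrightarrow> norm v0 \<le> W \<Longrightarrow> solution \<epsilon> x0 v0 x v \<Longrightarrow>
       ivp_solution reduced x0 xbar \<Longrightarrow>
       converges_exponentially_to_zero (\<lambda>t. x t - xbar t) \<and>
       converges_exponentially_to_zero (\<lambda>t. v t - h D \<omega> P \<phi> (xbar t))"
    by (fact exponential_approximation[OF \<Omega>[unfolded gk] W(1)])
  define K1 where "K1 = (\<Sum>i\<in>UNIV. 2 * S * K + 2 * S * (KB * H) / F i)"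
  have fast: "norm (v t - h D \<omega> P \<phi> (xbar t) - layer x0 v0 (t / \<epsilon>)) \<le> K1 * \<epsilon>"
    if "0 < \<epsilon>" "\<epsilon> < \<epsilon>1" "x0 \<in> \<Omega>" "v0 \<in> V" "solution \<epsilon> x0 v0 x v" "ivp_solution reduced x0 xbar" "0 \<le> t"
    for \<epsilon> x0 v0 x v xbar t
    unfolding K1_def
    by (rule fast_approximation[OF that(5,1,6) slow[OF that(1-3) W(2)[OF that(4)] that(5,6)] that(7)])
  have uniform: "norm (x t - xbar t) \<le> max K K1 * \<epsilon> \<and>
      norm (v t - h D \<omega> P \<phi> (xbar t) - layer x0 v0 (t / \<epsilon>)) \<le> max K K1 * \<epsilon>"
    if "0 < \<epsilon>" "\<epsilon> < \<epsilon>1" "x0 \<in> \<Omega>" "v0 \<in> V" "solution \<epsilon> x0 v0 x v" "ivp_solution reduced x0 xbar" "0 \<le> t"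
    for \<epsilon> x0 v0 x v xbar t
    using slow[OF that(1-3) W(2)[OF that(4)] that(5-7)] fast[OF that]
      mult_right_mono[OF max.cobounded1[of K K1], of \<epsilon>] mult_right_mono[OF max.cobounded2[of K1 K], of \<epsilon>] that(1)
    by linarith
  have late: "norm (v t - h D \<omega> P \<phi> (xbar t)) \<le> (K1 + (\<Sum>i\<in>UNIV. (W + H) / (F i * t_b))) * \<epsilon>"
    if "0 < t_b" "0 < \<epsilon>" "\<epsilon> < \<epsilon>1" "x0 \<in> \<Omega>" "v0 \<in> V" "solution \<epsilon> x0 v0 x v" "ivp_solution reduced x0 xbar" "t_b \<le> t"
    for t_b \<epsilon> x0 v0 x v xbar t
  proof -
    have "norm (v0 - h D \<omega> P \<phi> x0) \<le> W + H"
      using norm_triangle_ineq4[of v0 "h D \<omega> P \<phi> x0"] W(2)[OF that(5)] h_bound[of x0] by linarith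
    then have "norm (layer x0 v0 (t / \<epsilon>)) \<le> (\<Sum>i\<in>UNIV. (W + H) / (F i * t_b)) * \<epsilon>"
      using that by (intro layer_after_positive_time) auto
    moreover have "norm (v t - h D \<omega> P \<phi> (xbar t) - layer x0 v0 (t / \<epsilon>)) \<le> K1 * \<epsilon>"
      using that by (intro fast) auto
    ultimately show ?thesis
      using norm_triangle_ineq[of "v t - h D \<omega> P \<phi> (xbar t) - layer x0 v0 (t / \<epsilon>)" "layer x0 v0 (t / \<epsilon>)"]
      by (simp add: distrib_right)
  qed
  have vanish: "converges_exponentially_to_zero (\<lambda>t. x t - xbar t) \<and>
      converges_exponentially_to_zero (\<lambda>t. v t - h D \<omega> P \<phi> (xbar t) - layer x0 v0 (t / \<epsilon>)) \<and>
      converges_exponentially_to_zero (\<lambda>t. v t - h D \<omega> P \<phi> (xbar t))"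
    if "0 < \<epsilon>" "\<epsilon> < min \<epsilon>1 \<epsilon>e" "x0 \<in> \<Omega>" "v0 \<in> V" "solution \<epsilon> x0 v0 x v" "ivp_solution reduced x0 xbar"
    for \<epsilon> x0 v0 x v xbar
    using expo[OF that(1) _ that(3) W(2)[OF that(4)] that(5,6)] that(2)
      converges_exponentially_diff[OF _ layer_exponential[OF that(1)]] by auto
  show ?case
  proof (rule exI[of _ \<epsilon>1], intro conjI \<epsilon>1, goal_cases)
    case 1
    show ?case
      unfolding SP gk layer using unique uniform by (intro exI[of _ "max K K1"]) blast
  next
    case 2
    show ?case
    proof (intro allI impI, goal_cases)
      case (1 t_b)
      show ?case
        unfolding SP gk
        by (rule exI[of _ \<epsilon>1],
            intro conjI \<epsilon>1 order_refl exI[of _ "K1 + (\<Sum>i\<in>UNIV. (W + H) / (F i * t_b))"])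
           (use late[OF 1] in blast)
    qed
  next
    case 3
    show ?case
      unfolding SP gk layer using vanish \<epsilon>1 \<epsilon>e by (intro impI exI[of _ "min \<epsilon>1 \<epsilon>e"]) auto
  qed
qed simp

end
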